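(* Let $n=2$, let $\mathbf A\in L(\mathbb R^2)$ be an orthogonal operator, and assume there is a positive integer $m$ with $\mathbf A^m=\mathbf I$. Let $X^*(t)$, $t\ge0$, be the solution of $D_HX(t)=\mathbf AX(t)$ with $X^*(0)=X_0^*\in\mathfrak C$. Then $X^*(t)$ is conditionally asymptotically stable with respect to the set $$\mathfrak M=\Big\{X_0\in\operatorname{conv}\mathbb R^2 : \operatorname{int}X_0\neq\emptyset,\ \sum_{p=0}^{m-1}\mathbf A^pX_0\in\operatorname{Or}_{\mathfrak G}\Big(\sum_{p=0}^{m-1}\mathbf A^pX_0^*\Big)\Big\}.$$ That is: (i) for every $\varepsilon>0$ there exists $\delta=\delta(\varepsilon,X_0^* )>0$ such that for every $X_0\in\mathfrak C$ with $\rho[\operatorname{Or}_{\mathfrak G}(X_0),\operatorname{Or}_{\mathfrak G}(X_0^* )]<\delta$ the solution $X(t)$ of $D_HX(t)=\mathbf AX(t)$, $X(0)=X_0$, satisfies $\rho[\operatorname{Or}_{\mathfrak G}(X(t)),\operatorname{Or}_{\mathfrak G}(X^*(t))]<\varepsilon$ for all $t\ge0$; and (ii) there exists $\sigma_0>0$ such that for every $X_0\in\mathfrak M$ with $\rho[\operatorname{Or}_{\mathfrak G}(X_0),\operatorname{Or}_{\mathfrak G}(X_0^* )]<\sigma_0$, the solution $X(t)$ with $X(0)=X_0$ satisfies $\lim_{t\to\infty}\rho[\operatorname{Or}_{\mathfrak G}(X(t)),\operatorname{Or}_{\mathfrak G}(X^*(t))]=0$.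
   Context: $\operatorname{conv}\mathbb R^n$ is the space of nonempty convex compact subsets of $\mathbb R^n$ with the Hausdorff metric $d_H$; here $n=2$. $\mathfrak C=\{X\in\operatorname{conv}\mathbb R^n : \operatorname{int}X\neq\emptyset\}$. $\mathbf AX=\{\mathbf Ax: x\in X\}$; sums of sets are Minkowski sums. $V[X]$ is the volume (area if $n=2$). Hukuhara derivative: for $X,Y\in\operatorname{conv}\mathbb R^n$, the Hukuhara difference $X\ominus Y$ is the set $Z\in\operatorname{conv}\mathbb R^n$ with $X=Y+Z$, if it exists. $D_HX(t)$ is the element of $\operatorname{conv}\mathbb R^n$ that is the common $d_H$-limit, as $h\to0^+$, of $h^{-1}(X(t+h)\ominus X(t))$ and $h^{-1}(X(t)\ominus X(t-h))$ (only the first at $t=0$). The Cauchy problem $D_HX=\mathbf AX$, $X(0)=X_0$, has a unique solution on $[0,\infty)$, equivalently $X(t)=X_0+\int_0^t\mathbf AX(s)\,ds$ (set-valued integral); if $X_0\in\mathfrak C$ then $X(t)\in\mathfrak C$ for all $t\ge0$. $\mathfrak G$ is the group of homotheties $x\mapsto\lambda x+b$, $\lambda>0$, $b\in\mathbb R^n$, of $\mathbb R^n$, and $\operatorname{Or}_{\mathfrak G}(X)=\{\mathfrak gX:\mathfrak g\in\mathfrak G\}$ is the orbit (shape) of $X$. For $X\in\mathfrak C$ put $\widetilde X=X/\sqrt[n]{V[X]}$. For $X,Y\in\mathfrak C$, $$\rho[\operatorname{Or}_{\mathfrak G}(X),\operatorname{Or}_{\mathfrak G}(Y)]=\inf\{d_H(\widetilde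 X,\widetilde Y+x): x\in\mathbb R^n\}.$$ *)

theory Defs
  imports "HOL-Analysis.Analysis"
begin

definition conv_sets :: "'a::euclidean_space set set" where
  "conv_sets = {X. X \<noteq> {} \<and> convex X \<and> compact X}"

definition conv_bodies :: "'a::euclidean_space set set" where
  "conv_bodies = {X \<in> conv_sets. interior X \<noteq> {}}"

(* Only meaningful for nonempty bounded sets; Sup and infdist take junk values otherwise. *)
definition hausdist :: "'a::metric_space set \<Rightarrow> 'a set \<Rightarrow> real" where
  "hausdist X Y = max (SUP x\<in>X. infdist x Y) (SUP y\<in>Y. infdist y X)"

definition hukuhara_diff_exists :: "'a::euclidean_space set \<Rightarrow> 'a set \<Rightarrow> bool" where
  "hukuhara_diff_exists X Y \<longleftrightarrow> (\<exists>Z\<in>conv_sets. X = Y + Z)"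

definition hukuhara_diff :: "'a::euclidean_space set \<Rightarrow> 'a set \<Rightarrow> 'a set" where
  "hukuhara_diff X Y = (THE Z. Z \<in> conv_sets \<and> X = Y + Z)"

lemma hukuhara_diff_unique:
  fixes Y Z Z' :: "'a::euclidean_space set"
  assumes "Y \<in> conv_sets" "Z \<in> conv_sets" "Z' \<in> conv_sets" "Y + Z = Y + Z'"
  shows "Z = Z'"
proof -
  have "U \<subseteq> W" if U: "U \<in> conv_sets" and W: "W \<in> conv_sets" and eq: "Y + U = Y + W"
    for U W :: "'a set"
  proof (rule ccontr)
    assume "\<not> U \<subseteq> W"
    then obtain z where z: "z \<in> U" "z \<notin> W" by blast
    have "convex W" "closed W" using W by (auto simp: conv_sets_def compact_imp_closed)
    from separating_hyperplane_closed_point[OF this z(2)]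
    obtain a b where ab: "a \<bullet> z < b" "\<And>w. w \<in> W \<Longrightarrow> b < a \<bullet> w" by blast
    have "compact Y" "Y \<noteq> {}" using assms(1) by (auto simp: conv_sets_def)
    moreover have "continuous_on Y (\<lambda>x. a \<bullet> x)" by (intro continuous_intros)
    ultimately obtain y where y: "y \<in> Y" "\<And>x. x \<in> Y \<Longrightarrow> a \<bullet> y \<le> a \<bullet> x"
      using continuous_attains_inf[of Y "\<lambda>x. a \<bullet> x"] by auto
    have "y + z \<in> Y + W" unfolding eq[symmetric] using y(1) z(1) by (rule set_plus_intro)
    then obtain y' w where yw: "y' \<in> Y" "w \<in> W" "y + z = y' + w" by (auto elim: set_plus_elim)
    from arg_cong[OF yw(3), of "\<lambda>x. a \<bullet> x"]
    have "a \<bullet> y + a \<bullet> z = a \<bullet> y' + a \<bullet> w" by (simp only: inner_add_right)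
    then show False using y(2)[OF yw(1)] ab(1) ab(2)[OF yw(2)] by linarith
  qed
  from this[OF assms(2,3,4)] this[OF assms(3,2) assms(4)[symmetric]] show ?thesis by blast
qed

lemma hukuhara_diff_eq:
  fixes X Y Z :: "'a::euclidean_space set"
  assumes "Y \<in> conv_sets" "Z \<in> conv_sets" "X = Y + Z"
  shows "hukuhara_diff X Y = Z"
  unfolding hukuhara_diff_def
proof (rule the_equality)
  show "Z \<in> conv_sets \<and> X = Y + Z" using assms(2,3) by (rule conjI)
next
  fix W assume W: "W \<in> conv_sets \<and> X = Y + W"
  show "W = Z"
    by (rule hukuhara_diff_unique[OF assms(1) conjunct1[OF W] assms(2)])
      (rule trans[OF conjunct2[OF W, symmetric] assms(3)])
qed

(* Derivative on the half-line t \<ge> 0: the backward quotient is required only for t > 0. *)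
definition has_hukuhara_derivative ::
    "(real \<Rightarrow> 'a::euclidean_space set) \<Rightarrow> 'a set \<Rightarrow> real \<Rightarrow> bool" where
  "has_hukuhara_derivative X D t \<longleftrightarrow>
     D \<in> conv_sets \<and>
     (\<forall>\<^sub>F h in at_right 0. hukuhara_diff_exists (X (t + h)) (X t)) \<and>
     ((\<lambda>h. hausdist ((*\<^sub>R) (inverse h) ` hukuhara_diff (X (t + h)) (X t)) D) \<longlongrightarrow> 0) (at_right 0) \<and>
     (t > 0 \<longrightarrow>
       (\<forall>\<^sub>F h in at_right 0. hukuhara_diff_exists (X t) (X (t - h))) \<and>
       ((\<lambda>h. hausdist ((*\<^sub>R) (inverse h) ` hukuhara_diff (X t) (X (t - h))) D) \<longlongrightarrow> 0) (at_right 0))"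

definition hukuhara_solution ::
    "('a::euclidean_space \<Rightarrow> 'a) \<Rightarrow> 'a set \<Rightarrow> (real \<Rightarrow> 'a set) \<Rightarrow> bool" where
  "hukuhara_solution A X0 X \<longleftrightarrow>
     X 0 = X0 \<and> (\<forall>t\<ge>0. X t \<in> conv_sets \<and> has_hukuhara_derivative X (A ` X t) t)"

definition homotheties :: "('a::euclidean_space \<Rightarrow> 'a) set" where
  "homotheties = {g. \<exists>l b. l > 0 \<and> g = (\<lambda>x. l *\<^sub>R x + b)}"

definition orbit :: "'a::euclidean_space set \<Rightarrow> 'a set set" where
  "orbit X = {g ` X | g. g \<in> homotheties}"

definition vol_normalize :: "'a::euclidean_space set \<Rightarrow> 'a set" where
  "vol_normalize X = (*\<^sub>R) (inverse (root DIM('a) (measure lebesgue X))) ` X"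

definition body_dist :: "'a::euclidean_space set \<Rightarrow> 'a set \<Rightarrow> real" where
  "body_dist X Y = (INF x. hausdist (vol_normalize X) ((\<lambda>y. y + x) ` vol_normalize Y))"

(* The metric on shapes, i.e. on orbits of convex bodies; the value does not depend on the chosen
   representatives, see rho_orbit below. *)
definition rho :: "'a::euclidean_space set set \<Rightarrow> 'a set set \<Rightarrow> real" where
  "rho P Q = (THE r. \<exists>X\<in>conv_bodies. \<exists>Y\<in>conv_bodies.
     P = orbit X \<and> Q = orbit Y \<and> r = body_dist X Y)"

lemma hausdist_translation:
  fixes X Y :: "'a::real_normed_vector set"
  shows "hausdist ((\<lambda>x. x + c) ` X) ((\<lambda>x. x + c) ` Y) = hausdist X Y"
proof -
  have "infdist (x + c) ((\<lambda>x. x + c) ` Z) = infdist x Z" for x and Z :: "'a set"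
    by (simp add: infdist_def image_image)
  then show ?thesis by (simp add: hausdist_def image_image)
qed

lemma vol_normalize_homothety:
  fixes X :: "'a::euclidean_space set"
  assumes "l > 0"
  shows "\<exists>c. vol_normalize ((\<lambda>x. l *\<^sub>R x + b) ` X) = (\<lambda>x. x + c) ` vol_normalize X"
proof -
  let ?r = "root DIM('a) (measure lebesgue X)"
  have "measure lebesgue ((\<lambda>x. l *\<^sub>R x + b) ` X) = l ^ DIM('a) * measure lebesgue X"
    using assms measure_lebesgue_affine[of l b X] by simp
  then have "root DIM('a) (measure lebesgue ((\<lambda>x. l *\<^sub>R x + b) ` X)) = l * ?r"
    using assms by (simp add: real_root_mult real_root_power_cancel)
  moreover have "inverse (l * ?r) *\<^sub>R (l *\<^sub>R x + b) = inverse ?r *\<^sub>R x + inverse (l * ?r) *\<^sub>R b" for x :: 'a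
  proof -
    have "inverse (l * ?r) * l = inverse ?r" using assms by simp
    then show ?thesis by (simp only: scaleR_add_right scaleR_scaleR)
  qed
  ultimately have "vol_normalize ((\<lambda>x. l *\<^sub>R x + b) ` X)
      = (\<lambda>x. x + inverse (l * ?r) *\<^sub>R b) ` vol_normalize X"
    by (simp only: vol_normalize_def image_image)
  then show ?thesis by blast
qed

lemma body_dist_translation:
  assumes "vol_normalize X' = (\<lambda>x. x + c) ` vol_normalize X"
    and "vol_normalize Y' = (\<lambda>x. x + d) ` vol_normalize Y"
  shows "body_dist X' Y' = body_dist X Y"
proof -
  let ?f = "\<lambda>x. hausdist (vol_normalize X) ((\<lambda>y. y + x) ` vol_normalize Y)"
  have "hausdist (vol_normalize X') ((\<lambda>y. y + x) ` vol_normalize Y') = ?f (x + (d - c))" for x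
  proof -
    have "(\<lambda>y. y + x) ` vol_normalize Y' = (\<lambda>y. y + c) ` (\<lambda>y. y + (x + (d - c))) ` vol_normalize Y"
      by (simp add: assms image_image algebra_simps)
    then show ?thesis by (simp only: assms hausdist_translation)
  qed
  moreover have "range (\<lambda>x. ?f (x + (d - c))) = range ?f"
  proof -
    have "range (\<lambda>x. ?f (x + (d - c))) = ?f ` range (\<lambda>x. x + (d - c))"
      by (simp only: image_image)
    also have "range (\<lambda>x. x + (d - c)) = UNIV"
      by (rule surjI[of _ "\<lambda>x. x - (d - c)"]) simp
    finally show ?thesis .
  qed
  ultimately show ?thesis by (simp only: body_dist_def)
qed

lemma mem_orbit_self: "X \<in> orbit X"
proof -
  have "(\<lambda>x. x) \<in> homotheties"
    unfolding homotheties_def by (intro CollectI exI[of _ 1] exI[of _ 0]) simp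
  then show ?thesis unfolding orbit_def by (intro CollectI exI[of _ "\<lambda>x. x"]) simp
qed

lemma rho_orbit:
  assumes "X \<in> conv_bodies" "Y \<in> conv_bodies"
  shows "rho (orbit X) (orbit Y) = body_dist X Y"
proof -
  have *: "\<exists>c. vol_normalize X' = (\<lambda>x. x + c) ` vol_normalize X" if "orbit X' = orbit X"
    for X X' :: "'a set"
  proof -
    have "X' \<in> orbit X" using mem_orbit_self[of X'] by (simp only: that)
    then obtain l b where "l > 0" "X' = (\<lambda>x. l *\<^sub>R x + b) ` X"
      by (auto simp: orbit_def homotheties_def)
    then show ?thesis using vol_normalize_homothety[of l b X] by simp
  qed
  have **: "body_dist X' Y' = body_dist X Y" if "orbit X = orbit X'" "orbit Y = orbit Y'" for X' Y'
  proof -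
    from *[OF that(1)[symmetric]] *[OF that(2)[symmetric]]
    obtain c d where "vol_normalize X' = (\<lambda>x. x + c) ` vol_normalize X"
      "vol_normalize Y' = (\<lambda>x. x + d) ` vol_normalize Y" by (elim exE)
    then show ?thesis by (rule body_dist_translation)
  qed
  show ?thesis
    unfolding rho_def
  proof (rule the_equality)
    show "\<exists>X'\<in>conv_bodies. \<exists>Y'\<in>conv_bodies.
        orbit X = orbit X' \<and> orbit Y = orbit Y' \<and> body_dist X Y = body_dist X' Y'"
      by (rule bexI[OF bexI[OF _ assms(2)] assms(1)]) (intro conjI refl)
  next
    fix r
    assume "\<exists>X'\<in>conv_bodies. \<exists>Y'\<in>conv_bodies.
        orbit X = orbit X' \<and> orbit Y = orbit Y' \<and> r = body_dist X' Y'"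
    then obtain X' Y' where "orbit X = orbit X'" "orbit Y = orbit Y'" "r = body_dist X' Y'"
      by (elim bexE conjE)
    with **[of X' Y'] show "r = body_dist X Y" by (simp only:)
  qed
qed

definition conditionally_asymptotically_stable ::
    "('a::euclidean_space \<Rightarrow> 'a) \<Rightarrow> (real \<Rightarrow> 'a set) \<Rightarrow> 'a set set \<Rightarrow> bool" where
  "conditionally_asymptotically_stable A Xs M \<longleftrightarrow>
     (\<forall>\<epsilon>>0. \<exists>\<delta>>0. \<forall>X0\<in>conv_bodies. rho (orbit X0) (orbit (Xs 0)) < \<delta> \<longrightarrow>
        (\<forall>X. hukuhara_solution A X0 X \<longrightarrow> (\<forall>t\<ge>0. rho (orbit (X t)) (orbit (Xs t)) < \<epsilon>))) \<and>
     (\<exists>\<sigma>>0. \<forall>X0\<in>M. rho (orbit X0) (orbit (Xs 0)) < \<sigma> \<longrightarrow>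
        (\<forall>X. hukuhara_solution A X0 X \<longrightarrow>
          ((\<lambda>t. rho (orbit (X t)) (orbit (Xs t))) \<longlongrightarrow> 0) at_top))"

end

theory Submission
  imports Defs
begin

text \<open>
  In terms of support functions the equation \<open>D\<^sub>H X = A X\<close> reads \<open>\<partial>\<^sub>t h(t, A v) = h(t, v)\<close>. Since \<open>A\<^sup>m = I\<close>,
  the functions \<open>y\<^sub>p(t) = h(t, A\<^sup>p v)\<close> solve the finite cyclic linear system \<open>y\<^sub>p\<^sub>+\<^sub>1' = y\<^sub>p\<close>, which preserves
  nonnegativity and for which \<open>exp (- t) y\<^sub>p(t)\<close> tends to the mean of the initial values, at an exponential
  rate that is uniform in \<open>v\<close>.

  Preservation of nonnegativity yields stability: if \<open>X\<^sub>0\<close> is \<open>\<eta>\<close>-close to \<open>l X\<^sub>0\<^sup>* + c\<close>, then \<open>X(t)\<close> is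
  \<open>\<eta> exp t\<close>-close to \<open>l X\<^sup>*(t) + exp (t A) c\<close>, whereas the inradius of \<open>X\<^sup>*(t)\<close> also grows like \<open>exp t\<close>.
  If \<open>X\<^sub>0\<close> lies in the set \<open>\<MM>\<close>, the cyclic means of \<open>h\<close> and \<open>l h\<^sup>*\<close> differ by a linear functional, so
  \<open>exp (- t) X(t)\<close> and \<open>exp (- t) l X\<^sup>*(t)\<close> approach each other up to a translation.
\<close>

section \<open>Support functions\<close>

text \<open>The direction \<open>u\<close> is not restricted to unit vectors, so the estimates below
  carry a factor \<open>norm u\<close>. On \<open>conv_sets\<close> the supremum is attained, so its
  default value does not occur there.\<close>

definition support :: "'a::euclidean_space set \<Rightarrow> 'a \<Rightarrow> real" where
  "support X u = (SUP x\<in>X. u \<bullet> x)"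

lemma conv_setsD:
  assumes "X \<in> conv_sets"
  shows "X \<noteq> {}" "convex X" "compact X"
  using assms by (auto simp: conv_sets_def)

lemma conv_sets_plus:
  assumes "X \<in> conv_sets" "Y \<in> conv_sets"
  shows "X + Y \<in> conv_sets"
proof -
  have "X + Y = {x + y | x y. x \<in> X \<and> y \<in> Y}" by (auto simp: set_plus_def)
  then have "compact (X + Y)"
    using compact_sums[OF conv_setsD(3)[OF assms(1)] conv_setsD(3)[OF assms(2)]] by simp
  moreover have "convex (X + Y)" using assms by (intro convex_set_plus conv_setsD)
  moreover have "X + Y \<noteq> {}" using assms by (auto simp: conv_sets_def set_plus_def)
  ultimately show ?thesis by (simp add: conv_sets_def)
qed

lemma conv_sets_linear_image:
  assumes "linear f" "X \<in> conv_sets"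
  shows "f ` X \<in> conv_sets"
  using assms
  by (auto simp: conv_sets_def intro!: convex_linear_image compact_continuous_image linear_continuous_on
      linear_conv_bounded_linear[THEN iffD1])

lemma conv_sets_translation:
  assumes "X \<in> conv_sets"
  shows "(\<lambda>x. x + c) ` X \<in> conv_sets"
proof -
  have "(\<lambda>x. x + c) ` X = (+) c ` X" by (simp add: add.commute)
  then show ?thesis
    using assms convex_translation[of X c] compact_translation[of X c] by (simp add: conv_sets_def)
qed

lemma conv_sets_scaleR:
  assumes "X \<in> conv_sets"
  shows "(*\<^sub>R) s ` X \<in> conv_sets"
  using conv_sets_linear_image[OF _ assms] by (metis linear_scaleR)

lemma conv_sets_homothety:
  assumes "X \<in> conv_sets"
  shows "(\<lambda>x. s *\<^sub>R x + c) ` X \<in> conv_sets"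
  using conv_sets_translation[OF conv_sets_scaleR[OF assms, of s], of c] by (simp add: image_image)

lemma conv_sets_singleton: "{x} \<in> conv_sets"
  by (simp add: conv_sets_def)

lemma conv_sets_cball: "r \<ge> 0 \<Longrightarrow> cball x r \<in> conv_sets"
  by (simp add: conv_sets_def)

lemma support_attained:
  assumes "X \<in> conv_sets"
  obtains x where "x \<in> X" "support X u = u \<bullet> x" "\<And>y. y \<in> X \<Longrightarrow> u \<bullet> y \<le> u \<bullet> x"
proof -
  have "continuous_on X (\<lambda>x. u \<bullet> x)" by (intro continuous_intros)
  then obtain x where x: "x \<in> X" "\<And>y. y \<in> X \<Longrightarrow> u \<bullet> y \<le> u \<bullet> x"
    using continuous_attains_sup[of X "\<lambda>x. u \<bullet> x"] conv_setsD[OF assms] by auto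
  then have "support X u = u \<bullet> x"
    unfolding support_def by (intro cSup_eq_maximum) auto
  with x that show ?thesis by blast
qed

lemma support_upper: "X \<in> conv_sets \<Longrightarrow> x \<in> X \<Longrightarrow> u \<bullet> x \<le> support X u"
  by (metis support_attained)

lemma support_le: "X \<in> conv_sets \<Longrightarrow> (\<And>x. x \<in> X \<Longrightarrow> u \<bullet> x \<le> k) \<Longrightarrow> support X u \<le> k"
  by (metis support_attained)

lemma support_eqI:
  assumes "X \<in> conv_sets" "x \<in> X" "u \<bullet> x = k" "\<And>x. x \<in> X \<Longrightarrow> u \<bullet> x \<le> k"
  shows "support X u = k"
  using support_upper[OF assms(1,2), of u] support_le[OF assms(1,4)] assms(3) by simp

lemma support_plus:
  assumes "X \<in> conv_sets" "Y \<in> conv_sets"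
  shows "support (X + Y) u = support X u + support Y u"
proof -
  obtain x where x: "x \<in> X" "support X u = u \<bullet> x" using support_attained[OF assms(1)] by metis
  obtain y where y: "y \<in> Y" "support Y u = u \<bullet> y" using support_attained[OF assms(2)] by metis
  show ?thesis
  proof (rule support_eqI[OF conv_sets_plus[OF assms], of "x + y"])
    show "x + y \<in> X + Y" using x y by auto
    show "u \<bullet> (x + y) = support X u + support Y u" using x y by (simp add: inner_add_right)
    fix z assume "z \<in> X + Y"
    then obtain a b where "z = a + b" "a \<in> X" "b \<in> Y" by (auto elim: set_plus_elim)
    then show "u \<bullet> z \<le> support X u + support Y u"
      using support_upper[OF assms(1), of a u] support_upper[OF assms(2), of b u]
      by (simp add: inner_add_right)
  qed
qed

lemma conv_sets_sum: "(\<And>p. F p \<in> conv_sets) \<Longrightarrow> (\<Sum>p<k. F p) \<in> conv_sets" for k :: nat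
  by (induction k) (simp_all add: conv_sets_plus set_zero conv_sets_singleton)

lemma support_sum:
  fixes k :: nat
  assumes "\<And>p. F p \<in> conv_sets"
  shows "support (\<Sum>p<k. F p) u = (\<Sum>p<k. support (F p) u)"
proof (induction k)
  case 0
  then show ?case by (simp add: set_zero support_def)
next
  case (Suc k)
  then show ?case using assms by (simp add: support_plus conv_sets_sum)
qed

lemma support_homothety:
  assumes "X \<in> conv_sets" "s \<ge> 0"
  shows "support ((\<lambda>x. s *\<^sub>R x + c) ` X) u = s * support X u + u \<bullet> c"
proof -
  obtain x where x: "x \<in> X" "support X u = u \<bullet> x" "\<And>y. y \<in> X \<Longrightarrow> u \<bullet> y \<le> u \<bullet> x"
    using support_attained[OF assms(1)] by metis
  show ?thesis
    by (rule support_eqI[OF conv_sets_homothety[OF assms(1)], of "s *\<^sub>R x + c"])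
      (use x assms(2) in \<open>auto simp: inner_add_right intro!: mult_left_mono\<close>)
qed

lemma support_scaleR:
  assumes "X \<in> conv_sets" "s \<ge> 0"
  shows "support ((*\<^sub>R) s ` X) u = s * support X u"
  using support_homothety[OF assms, of 0 u] by simp

lemma support_translation:
  assumes "X \<in> conv_sets"
  shows "support ((\<lambda>x. x + c) ` X) u = support X u + u \<bullet> c"
  using support_homothety[OF assms, of 1 c u] by simp

text \<open>Since \<open>A u \<bullet> A x = u \<bullet> x\<close>, moving the set and the direction
  together changes nothing. This turns the right-hand side of the differential equation into an
  index shift along the powers of \<open>A\<close>.\<close>

lemma support_orthogonal_image:
  assumes "orthogonal_transformation A"
  shows "support (A ` X) (A u) = support X u"
  using assms by (simp add: support_def image_image orthogonal_transformation_def)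

lemma support_cball:
  assumes "r \<ge> 0"
  shows "support (cball x r) u = u \<bullet> x + r * norm u"
proof (rule support_eqI[OF conv_sets_cball[OF assms], of "x + r *\<^sub>R sgn u"])
  show "x + r *\<^sub>R sgn u \<in> cball x r" using assms by (auto simp: dist_norm norm_sgn)
  show "u \<bullet> (x + r *\<^sub>R sgn u) = u \<bullet> x + r * norm u"
    by (cases "u = 0") (simp_all add: inner_add_right sgn_div_norm dot_square_norm power2_eq_square field_simps)
  fix y assume "y \<in> cball x r"
  then have "norm u * norm (y - x) \<le> norm u * r"
    by (intro mult_left_mono) (auto simp: dist_norm norm_minus_commute)
  then show "u \<bullet> y \<le> u \<bullet> x + r * norm u"
    using norm_cauchy_schwarz[of u "y - x"] by (simp add: inner_diff_right mult.commute)
qed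

text \<open>A point of \<open>X\<close> outside \<open>Y\<close> would be strictly separated from
  \<open>Y\<close>. The separation theorem puts \<open>Y\<close> on the upper side, so the direction
  contradicting the hypothesis is \<open>- a\<close>.\<close>

lemma support_subset:
  assumes "X \<in> conv_sets" "Y \<in> conv_sets" "\<And>u. support X u \<le> support Y u"
  shows "X \<subseteq> Y"
proof
  fix x assume x: "x \<in> X"
  show "x \<in> Y"
  proof (rule ccontr)
    assume "x \<notin> Y"
    moreover have "convex Y" "closed Y" using conv_setsD[OF assms(2)] by (auto simp: compact_imp_closed)
    ultimately obtain a b where ab: "a \<bullet> x < b" "\<And>w. w \<in> Y \<Longrightarrow> b < a \<bullet> w"
      using separating_hyperplane_closed_point[of Y x] by blast
    have "support Y (- a) \<le> - b"
      using ab(2) by (intro support_le[OF assms(2)]) force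
    then show False
      using assms(3)[of "- a"] support_upper[OF assms(1) x, of "- a"] ab(1) by simp
  qed
qed

section \<open>Hausdorff distance in terms of support functions\<close>

lemma bdd_above_infdist:
  fixes X :: "'a::euclidean_space set"
  assumes "X \<in> conv_sets"
  shows "bdd_above ((\<lambda>x. infdist x Y) ` X)"
  using assms
  by (intro bounded_imp_bdd_above compact_imp_bounded compact_continuous_image continuous_intros conv_setsD)

lemma infdist_le_hausdist:
  fixes X :: "'a::euclidean_space set"
  assumes "X \<in> conv_sets" "x \<in> X"
  shows "infdist x Y \<le> hausdist X Y"
  unfolding hausdist_def using cSUP_upper[OF assms(2) bdd_above_infdist[OF assms(1)]]
  by (rule max.coboundedI1)

lemma hausdist_nonneg:
  fixes X :: "'a::euclidean_space set"
  assumes "X \<in> conv_sets"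
  shows "0 \<le> hausdist X Y"
proof -
  obtain x where "x \<in> X" using conv_setsD(1)[OF assms] by blast
  then show ?thesis using infdist_le_hausdist[OF assms] infdist_nonneg[of x Y] by (meson order_trans)
qed

lemma hausdist_commute: "hausdist X Y = hausdist Y X"
  by (simp add: hausdist_def max.commute)

text \<open>Compare a point maximizing the functional \<open>u\<close> on one set with its nearest
  point in the other and apply Cauchy-Schwarz. With \<open>hausdist_le_support\<close> this
  identifies the Hausdorff distance with the uniform distance of support functions on the unit
  sphere.\<close>

lemma support_diff_le_hausdist:
  fixes X Y :: "'a::euclidean_space set"
  assumes "X \<in> conv_sets" "Y \<in> conv_sets"
  shows "\<bar>support X u - support Y u\<bar> \<le> hausdist X Y * norm u"
proof -
  have *: "support V u \<le> support W u + hausdist V W * norm u"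
    if V: "V \<in> conv_sets" and W: "W \<in> conv_sets" for V W :: "'a set"
  proof -
    obtain x where x: "x \<in> V" "support V u = u \<bullet> x" using support_attained[OF V] by metis
    obtain y where y: "y \<in> W" "infdist x W = dist x y"
      using infdist_attains_inf[of W x] conv_setsD[OF W] compact_imp_closed by metis
    have "norm (x - y) \<le> hausdist V W"
      using infdist_le_hausdist[OF V x(1), of W] y(2) by (simp add: dist_norm)
    then have "norm u * norm (x - y) \<le> norm u * hausdist V W" by (intro mult_left_mono) auto
    moreover have "u \<bullet> x = u \<bullet> y + u \<bullet> (x - y)" by (simp add: inner_diff_right)
    ultimately show ?thesis
      using norm_cauchy_schwarz[of u "x - y"] support_upper[OF W y(1), of u] x(2)
      by (simp add: mult.commute)
  qed
  show ?thesis
    using *[OF assms] *[OF assms(2,1)] by (simp add: hausdist_commute[of Y X] abs_le_iff)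
qed

text \<open>As \<open>e * norm u\<close> is the support function of \<open>cball 0 e\<close>, the
  hypothesis places each set inside the other one fattened by that ball.\<close>

lemma hausdist_le_support:
  fixes X Y :: "'a::euclidean_space set"
  assumes "X \<in> conv_sets" "Y \<in> conv_sets" "e \<ge> 0"
    and "\<And>u. \<bar>support X u - support Y u\<bar> \<le> e * norm u"
  shows "hausdist X Y \<le> e"
proof -
  have *: "(SUP x\<in>V. infdist x W) \<le> e"
    if V: "V \<in> conv_sets" and W: "W \<in> conv_sets" and le: "\<And>u. support V u \<le> support W u + e * norm u"
    for V W :: "'a set"
  proof (rule cSUP_least)
    show "V \<noteq> {}" using V by (rule conv_setsD)
    fix x assume x: "x \<in> V"
    have "V \<subseteq> W + cball 0 e"
      using V W le \<open>e \<ge> 0\<close>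
      by (intro support_subset conv_sets_plus conv_sets_cball) (simp_all add: support_plus conv_sets_cball support_cball)
    with x obtain w b where "x = w + b" "w \<in> W" "norm b \<le> e" by (auto elim!: set_plus_elim)
    then show "infdist x W \<le> e" using infdist_le2[of w W x e] by (simp add: dist_norm)
  qed
  have "support X u \<le> support Y u + e * norm u" "support Y u \<le> support X u + e * norm u" for u
    using assms(4)[of u] by auto
  then show ?thesis
    unfolding hausdist_def using *[OF assms(1,2)] *[OF assms(2,1)] by auto
qed

text \<open>One interior point \<open>x\<close> is the common centre of an inner and an enclosing
  ball; the bounds come from their support functions.\<close>

lemma conv_bodies_support_bounds:
  assumes "X \<in> conv_bodies"
  obtains x r R where "r > 0" "R > 0"
    "\<And>u. r * norm u \<le> support X u - u \<bullet> x" "\<And>u. support X u - u \<bullet> x \<le> R * norm u"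
proof -
  have X: "X \<in> conv_sets" using assms by (simp add: conv_bodies_def)
  obtain x where "x \<in> interior X" using assms by (auto simp: conv_bodies_def)
  then obtain r where r: "r > 0" "cball x r \<subseteq> X" by (auto simp: mem_interior_cball)
  obtain R where R: "R > 0" "X \<subseteq> cball x R"
  proof -
    obtain R where "\<forall>y\<in>X. dist x y \<le> R"
      using compact_imp_bounded[OF conv_setsD(3)[OF X]] bounded_any_center[of X x] by blast
    \<comment> \<open>The maximum with 1 makes the outer radius positive.\<close>
    then have "X \<subseteq> cball x (max R 1)" by force
    then show ?thesis by (intro that[of "max R 1"]) auto
  qed
  have mono: "support V u \<le> support W u"
    if "V \<in> conv_sets" "W \<in> conv_sets" "V \<subseteq> W" for V W :: "'a set" and u
    using that by (meson support_le support_upper subsetD)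
  show ?thesis
  proof (rule that[OF r(1) R(1)])
    show "r * norm u \<le> support X u - u \<bullet> x" for u
      using mono[OF conv_sets_cball X r(2), of u] r(1) by (simp add: support_cball)
    show "support X u - u \<bullet> x \<le> R * norm u" for u
      using mono[OF X conv_sets_cball R(2), of u] R(1) by (simp add: support_cball)
  qed
qed

lemma conv_bodies_if_support_ge:
  assumes "X \<in> conv_sets" "r > 0" "\<And>u. r * norm u \<le> support X u - u \<bullet> x"
  shows "X \<in> conv_bodies"
proof -
  have "cball x r \<subseteq> X"
    using assms(2,3) by (intro support_subset conv_sets_cball assms(1)) (auto simp: support_cball algebra_simps)
  then have "ball x r \<subseteq> interior X"
    by (meson ball_subset_cball interior_maximal open_ball subset_trans)
  then have "interior X \<noteq> {}" using assms(2) centre_in_ball by blast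
  then show ?thesis using assms(1) by (simp add: conv_bodies_def)
qed

section \<open>Volume normalization\<close>

text \<open>The divisor used by \<open>vol_normalize\<close>; up to a constant depending on the
  dimension, the radius of the ball of equal volume. Unlike the volume it scales linearly under
  homotheties.\<close>

definition vol_radius :: "'a::euclidean_space set \<Rightarrow> real" where
  "vol_radius X = root DIM('a) (measure lebesgue X)"

lemma vol_radius_mono:
  fixes X Y :: "'a::euclidean_space set"
  assumes "X \<in> conv_sets" "Y \<in> conv_sets" "X \<subseteq> Y"
  shows "vol_radius X \<le> vol_radius Y"
  unfolding vol_radius_def using assms
  by (auto intro!: measure_mono_fmeasurable lmeasurable_compact fmeasurableD conv_setsD)

lemma vol_radius_homothety:
  fixes X :: "'a::euclidean_space set"
  assumes "s \<ge> 0"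
  shows "vol_radius ((\<lambda>x. s *\<^sub>R x + c) ` X) = s * vol_radius X"
  using assms by (simp add: vol_radius_def measure_lebesgue_affine real_root_mult real_root_power_cancel)

lemma vol_radius_unit_ball_pos: "vol_radius (cball (0::'a::euclidean_space) 1) > 0"
proof -
  have "measure lebesgue (cball (0::'a) 1) > 0"
    using content_cball_pos[of 1 "0::'a"] by (simp add: measure_completion)
  then show ?thesis by (simp add: vol_radius_def)
qed

lemma vol_radius_ge_if_support_ge:
  fixes X :: "'a::euclidean_space set"
  assumes "X \<in> conv_sets" "r > 0" "\<And>u. r * norm u \<le> support X u - u \<bullet> x"
  shows "r * vol_radius (cball (0::'a) 1) \<le> vol_radius X"
proof -
  have "(\<lambda>y. r *\<^sub>R y + x) ` cball 0 1 \<subseteq> X"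
  proof (intro support_subset conv_sets_homothety conv_sets_cball assms(1))
    fix u
    have "support ((\<lambda>y. r *\<^sub>R y + x) ` cball 0 1) u = r * norm u + u \<bullet> x"
      using assms(2) by (subst support_homothety) (simp_all add: conv_sets_cball support_cball)
    then show "support ((\<lambda>y. r *\<^sub>R y + x) ` cball 0 1) u \<le> support X u"
      using assms(3)[of u] by simp
  qed simp
  then show ?thesis
    using vol_radius_mono[OF conv_sets_homothety[OF conv_sets_cball] assms(1)] vol_radius_homothety assms(2)
    by (metis less_eq_real_def zero_le_one)
qed

text \<open>Since \<open>q r |u| \<le> q (support Y u - u \<bullet> y)\<close>, the set \<open>X\<close> lies between two homothetic copies of
  \<open>Y\<close> with ratios \<open>(1 - q) l\<close> and \<open>(1 + q) l\<close>, which controls its volume.\<close>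

lemma body_dist_le_support:
  fixes X Y :: "'a::euclidean_space set"
  assumes X: "X \<in> conv_sets" and Y: "Y \<in> conv_sets" and "l > 0" "r > 0" "0 \<le> q" "q \<le> 1/2"
    and lower: "\<And>u. r * norm u \<le> support Y u - u \<bullet> y"
    and upper: "\<And>u. support Y u - u \<bullet> y \<le> R * norm u"
    and close: "\<And>u. \<bar>support X u - l * support Y u - u \<bullet> c\<bar> \<le> q * l * r * norm u"
  shows "body_dist X Y \<le> 2 * q / vol_radius (cball (0::'a) 1) * (1 + R / r)"
proof -
  define \<kappa> where "\<kappa> = vol_radius (cball (0::'a) 1)"
  define a where "a = vol_radius X"
  define b where "b = vol_radius Y"
  \<comment> \<open>\<open>k\<close> is the support function of \<open>Y\<close> seen from
    \<open>y\<close>, hence nonnegative and comparable with \<open>norm u\<close>.\<close>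
  define k where "k u = support Y u - u \<bullet> y" for u
  define c' where "c' = c + l *\<^sub>R y"
  define e where "e u = support X u - l * k u - u \<bullet> c'" for u
  have e: "\<bar>e u\<bar> \<le> q * l * r * norm u" for u
    using close[of u] by (simp add: e_def k_def c'_def algebra_simps)
  have k: "r * norm u \<le> k u" "k u \<le> R * norm u" for u
    using lower[of u] upper[of u] by (auto simp: k_def)
  have eq: "\<bar>e u\<bar> \<le> q * l * k u" for u
  proof -
    have "q * l * (r * norm u) \<le> q * l * k u"
      using k(1) \<open>0 \<le> q\<close> \<open>l > 0\<close> by (intro mult_left_mono) auto
    with e[of u] show ?thesis by (simp add: mult.assoc)
  qed
  \<comment> \<open>The translation part sends \<open>y\<close> to \<open>c'\<close>, so all copies
    share the centre \<open>c'\<close> and their support functions differ only in the factor of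
    \<open>k u\<close>.\<close>
  let ?Y = "\<lambda>s. (\<lambda>x. s *\<^sub>R x + (c' - s *\<^sub>R y)) ` Y"
  have supp: "support (?Y s) u = s * k u + u \<bullet> c'" if "s \<ge> 0" for s u
    using that unfolding support_homothety[OF Y that] by (simp add: k_def algebra_simps)
  have "?Y ((1 - q) * l) \<subseteq> X"
    using \<open>q \<le> 1/2\<close> \<open>l > 0\<close> eq
    by (intro support_subset conv_sets_homothety X Y, subst supp) (auto simp: e_def abs_le_iff algebra_simps)
  then have a1: "(1 - q) * l * b \<le> a"
    using vol_radius_mono[OF conv_sets_homothety[OF Y] X] vol_radius_homothety[of "(1 - q) * l" "c' - ((1 - q) * l) *\<^sub>R y" Y]
      \<open>q \<le> 1/2\<close> \<open>l > 0\<close> unfolding a_def b_def by fastforce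
  have "X \<subseteq> ?Y ((1 + q) * l)"
    using \<open>q \<ge> 0\<close> \<open>l > 0\<close> eq
    by (intro support_subset conv_sets_homothety X Y, subst supp) (auto simp: e_def abs_le_iff algebra_simps)
  then have a2: "a \<le> (1 + q) * l * b"
    using vol_radius_mono[OF X conv_sets_homothety[OF Y]] vol_radius_homothety[of "(1 + q) * l" "c' - ((1 + q) * l) *\<^sub>R y" Y]
      \<open>q \<ge> 0\<close> \<open>l > 0\<close> unfolding a_def b_def by fastforce
  have "\<kappa> > 0" unfolding \<kappa>_def by (rule vol_radius_unit_ball_pos)
  have b: "r * \<kappa> \<le> b"
    unfolding b_def \<kappa>_def using Y \<open>r > 0\<close> lower by (rule vol_radius_ge_if_support_ge)
  then have "b > 0" using \<open>\<kappa> > 0\<close> \<open>r > 0\<close> by (smt (verit) mult_pos_pos)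
  \<comment> \<open>Here \<open>q \<le> 1/2\<close> enters: it bounds \<open>l / a\<close> by
    \<open>2 / b\<close>, which produces the factor 2 in the final estimate.\<close>
  have a3: "l * b / 2 \<le> a"
  proof -
    have "1/2 * (l * b) \<le> (1 - q) * (l * b)"
      using \<open>q \<le> 1/2\<close> \<open>l > 0\<close> \<open>b > 0\<close> by (intro mult_right_mono) auto
    with a1 show ?thesis by simp
  qed
  then have "a > 0" using \<open>l > 0\<close> \<open>b > 0\<close> by (smt (verit) mult_pos_pos divide_pos_pos)
  have R: "R > 0"
  proof -
    obtain u :: 'a where "norm u = 1" using vector_choose_size[of 1] by auto
    with k[of u] \<open>r > 0\<close> show ?thesis by simp
  qed
  have la: "l / a \<le> 2 / (r * \<kappa>)"
  proof -
    have "l / a \<le> 2 / b" using a3 \<open>a > 0\<close> \<open>b > 0\<close> by (simp add: field_simps)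
    also have "\<dots> \<le> 2 / (r * \<kappa>)" using b \<open>r > 0\<close> \<open>\<kappa> > 0\<close> \<open>b > 0\<close> by (intro divide_left_mono) auto
    finally show ?thesis .
  qed
  \<comment> \<open>This translation carries the normalized centre
    \<open>inverse b *\<^sub>R y\<close> to \<open>inverse a *\<^sub>R c'\<close>.\<close>
  let ?x = "inverse a *\<^sub>R c' - inverse b *\<^sub>R y"
  let ?d = "2 * q / \<kappa> * (1 + R / r)"
  have nX: "vol_normalize X = (*\<^sub>R) (inverse a) ` X" and nY: "vol_normalize Y = (*\<^sub>R) (inverse b) ` Y"
    by (simp_all add: vol_normalize_def a_def b_def vol_radius_def)
  have cX: "vol_normalize X \<in> conv_sets" and cY: "vol_normalize Y \<in> conv_sets"
    using X Y by (simp_all add: nX nY conv_sets_scaleR)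
  have "hausdist (vol_normalize X) ((\<lambda>z. z + ?x) ` vol_normalize Y) \<le> ?d"
  proof (rule hausdist_le_support[OF cX conv_sets_translation[OF cY]])
    show "?d \<ge> 0" using \<open>\<kappa> > 0\<close> \<open>q \<ge> 0\<close> R \<open>r > 0\<close> by auto
    fix u
    have 1: "support (vol_normalize X) u = support X u / a"
      using \<open>a > 0\<close> by (simp add: nX support_scaleR[OF X] field_simps)
    have 2: "support ((\<lambda>z. z + ?x) ` vol_normalize Y) u = support Y u / b + u \<bullet> ?x"
      using \<open>b > 0\<close> by (simp add: support_translation[OF cY]) (simp add: nY support_scaleR[OF Y] field_simps)
    \<comment> \<open>The difference splits into the approximation error and the mismatch of the two
      normalizing factors; each is of order \<open>q\<close>.\<close>
    have 3: "support X u / a - (support Y u / b + u \<bullet> ?x) = e u / a + k u * (l / a - 1 / b)"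
      using \<open>a > 0\<close> \<open>b > 0\<close> by (simp add: e_def k_def inner_diff_right field_simps)
    have 4: "\<bar>e u / a\<bar> \<le> q * r * norm u * (l / a)"
      using e[of u] \<open>a > 0\<close> by (simp add: field_simps)
    have "l / a - 1 / b = (l * b - a) / (a * b)" using \<open>a > 0\<close> \<open>b > 0\<close> by (simp add: field_simps)
    then have "\<bar>l / a - 1 / b\<bar> = \<bar>l * b - a\<bar> / (a * b)" using \<open>a > 0\<close> \<open>b > 0\<close> by simp
    also have "\<dots> \<le> (q * l * b) / (a * b)"
      using a1 a2 \<open>a > 0\<close> \<open>b > 0\<close> by (intro divide_right_mono) (auto simp: algebra_simps abs_le_iff)
    also have "\<dots> = q * (l / a)" using \<open>b > 0\<close> by simp
    finally have 5: "\<bar>l / a - 1 / b\<bar> \<le> q * (l / a)" .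
    have "0 \<le> k u" using k(1)[of u] \<open>r > 0\<close> by (smt (verit) mult_nonneg_nonneg norm_ge_zero)
    then have "\<bar>k u * (l / a - 1 / b)\<bar> \<le> R * norm u * (q * (l / a))"
      unfolding abs_mult using k(2)[of u] 5 R by (intro mult_mono) auto
    then have "\<bar>e u / a + k u * (l / a - 1 / b)\<bar> \<le> q * r * norm u * (l / a) + R * norm u * (q * (l / a))"
      using 4 by linarith
    also have "\<dots> = q * norm u * (r + R) * (l / a)" by (simp add: algebra_simps)
    also have "\<dots> \<le> q * norm u * (r + R) * (2 / (r * \<kappa>))"
      using la \<open>q \<ge> 0\<close> R \<open>r > 0\<close> by (intro mult_left_mono) auto
    also have "\<dots> = ?d * norm u" using \<open>r > 0\<close> \<open>\<kappa> > 0\<close> by (simp add: field_simps)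
    finally show "\<bar>support (vol_normalize X) u - support ((\<lambda>z. z + ?x) ` vol_normalize Y) u\<bar> \<le> ?d * norm u"
      unfolding 1 2 3 .
  qed
  moreover have "body_dist X Y \<le> hausdist (vol_normalize X) ((\<lambda>z. z + ?x) ` vol_normalize Y)"
    unfolding body_dist_def by (intro cINF_lower bdd_belowI2[where m = 0] hausdist_nonneg cX UNIV_I)
  ultimately show ?thesis by (simp add: \<kappa>_def)
qed

lemma body_dist_nonneg:
  assumes "X \<in> conv_sets"
  shows "body_dist X Y \<ge> 0"
  unfolding body_dist_def
  using assms by (intro cINF_greatest hausdist_nonneg) (auto simp: vol_normalize_def conv_sets_scaleR)

text \<open>A translation \<open>x\<close> nearly attaining the infimum is rescaled by the volume
  radius of \<open>X\<close>, which undoes the normalization. The ratio of the volume radii becomes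
  \<open>l\<close>, so \<open>d * vol_radius Y * l\<close> is just
  \<open>d * vol_radius X\<close>.\<close>

lemma support_close_if_body_dist_less:
  fixes X Y :: "'a::euclidean_space set"
  assumes "X \<in> conv_bodies" "Y \<in> conv_bodies" "body_dist X Y < d"
  obtains l c where "l > 0"
    "\<And>u. \<bar>support X u - l * support Y u - u \<bullet> c\<bar> \<le> d * vol_radius Y * l * norm u"
proof -
  have X: "X \<in> conv_sets" and Y: "Y \<in> conv_sets" using assms by (auto simp: conv_bodies_def)
  have pos: "vol_radius Z > 0" if Z: "Z \<in> conv_bodies" for Z :: "'a set"
  proof -
    obtain z r where "r > 0" "\<And>u. r * norm u \<le> support Z u - u \<bullet> z"
      by (rule conv_bodies_support_bounds[OF Z]) blast
    moreover have "Z \<in> conv_sets" using Z by (simp add: conv_bodies_def)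
    ultimately show ?thesis
      using vol_radius_ge_if_support_ge[of Z r z] vol_radius_unit_ball_pos[where 'a='a]
      by (smt (verit) mult_pos_pos)
  qed
  define a where "a = vol_radius X"
  define b where "b = vol_radius Y"
  have "a > 0" "b > 0" using pos assms by (auto simp: a_def b_def)
  have nX: "vol_normalize X = (*\<^sub>R) (inverse a) ` X" and nY: "vol_normalize Y = (*\<^sub>R) (inverse b) ` Y"
    by (simp_all add: vol_normalize_def a_def b_def vol_radius_def)
  have cX: "vol_normalize X \<in> conv_sets" and cY: "vol_normalize Y \<in> conv_sets"
    using X Y by (simp_all add: nX nY conv_sets_scaleR)
  obtain x where x: "hausdist (vol_normalize X) ((\<lambda>z. z + x) ` vol_normalize Y) < d"
    using cInf_lessD[OF _ assms(3)[unfolded body_dist_def]] by auto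
  show ?thesis
  proof (rule that[of "a / b" "a *\<^sub>R x"])
    show "a / b > 0" using \<open>a > 0\<close> \<open>b > 0\<close> by simp
    fix u
    have "\<bar>support (vol_normalize X) u - support ((\<lambda>z. z + x) ` vol_normalize Y) u\<bar> \<le> d * norm u"
      using support_diff_le_hausdist[OF cX conv_sets_translation[OF cY], of u x] x
      by (smt (verit) mult_right_mono norm_ge_zero)
    moreover have "support (vol_normalize X) u = support X u / a"
      using \<open>a > 0\<close> by (simp add: nX support_scaleR[OF X] field_simps)
    moreover have "support ((\<lambda>z. z + x) ` vol_normalize Y) u = support Y u / b + u \<bullet> x"
      using \<open>b > 0\<close> by (simp add: support_translation[OF cY]) (simp add: nY support_scaleR[OF Y] field_simps)
    ultimately have "a * \<bar>support X u / a - (support Y u / b + u \<bullet> x)\<bar> \<le> a * (d * norm u)"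
      using \<open>a > 0\<close> by simp
    moreover have "a * \<bar>support X u / a - (support Y u / b + u \<bullet> x)\<bar>
        = \<bar>a * (support X u / a - (support Y u / b + u \<bullet> x))\<bar>" using \<open>a > 0\<close> by (simp add: abs_mult)
    moreover have "a * (support X u / a - (support Y u / b + u \<bullet> x))
        = support X u - a / b * support Y u - u \<bullet> (a *\<^sub>R x)"
      using \<open>a > 0\<close> \<open>b > 0\<close> by (simp add: field_simps)
    ultimately show "\<bar>support X u - a / b * support Y u - u \<bullet> (a *\<^sub>R x)\<bar> \<le> d * vol_radius Y * (a / b) * norm u"
      using \<open>b > 0\<close> by (simp add: b_def[symmetric] field_simps)
  qed
qed

section \<open>The cyclic linear system\<close>

text \<open>The product \<open>E s * exp (- (k * s))\<close> has nonpositive derivative. The sign of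
  \<open>k\<close> is free: \<open>k = 2\<close> serves to preserve nonnegativity, a negative
  \<open>k\<close> gives decay.\<close>

lemma gronwall_exp:
  fixes E E' :: "real \<Rightarrow> real"
  assumes "\<And>t. t \<ge> 0 \<Longrightarrow> (E has_real_derivative E' t) (at t within {0..})"
    and "\<And>t. t \<ge> 0 \<Longrightarrow> E' t \<le> k * E t" and "t \<ge> 0"
  shows "E t \<le> E 0 * exp (k * t)"
proof -
  define G where "G s = E s * exp (- (k * s))" for s
  have D: "(G has_real_derivative (E' s - k * E s) * exp (- (k * s))) (at s within {0..})" if "s \<ge> 0" for s
    unfolding G_def by (rule derivative_eq_intros assms(1)[OF that] refl)+ (simp add: algebra_simps)
  have "G t \<le> G 0"
  proof (cases "t = 0")
    case False
    with \<open>t \<ge> 0\<close> have "0 < t" by simp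
    then show ?thesis
    proof (rule DERIV_nonpos_imp_decreasing_open[OF less_imp_le])
      fix s assume s: "0 < s" "s < t"
      \<comment> \<open>Inside the half-line the one-sided derivative is an ordinary one.\<close>
      have "at s within {0..} = at s" using s by (intro at_within_interior) simp
      with D[of s] s have "(G has_real_derivative (E' s - k * E s) * exp (- (k * s))) (at s)" by simp
      moreover have "(E' s - k * E s) * exp (- (k * s)) \<le> 0"
        using assms(2)[of s] s by (intro mult_nonpos_nonneg) auto
      ultimately show "\<exists>y. (G has_real_derivative y) (at s) \<and> y \<le> 0" by blast
    next
      have "continuous_on {0..} G"
        using D by (intro DERIV_continuous_on) auto
      then show "continuous_on {0..t} G" by (rule continuous_on_subset) auto
    qed
  qed simp
  then have "E t * exp (- (k * t)) * exp (k * t) \<le> E 0 * exp (k * t)"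
    by (intro mult_right_mono) (auto simp: G_def)
  then show ?thesis by (simp add: mult.assoc flip: exp_add)
qed

text \<open>Squaring removes the kink of \<open>min x 0\<close> at the origin, so negative parts can
  enter a differentiable energy.\<close>

lemma has_real_derivative_neg_part_square:
  "((\<lambda>x. (min x 0)\<^sup>2) has_real_derivative 2 * min x 0) (at x)" for x :: real
proof -
  consider "x < 0" | "x = 0" | "x > 0" by linarith
  then show ?thesis
  proof cases
    case 1
    have "((\<lambda>x. x\<^sup>2) has_real_derivative 2 * x) (at x)" by (auto intro!: derivative_eq_intros)
    then have "((\<lambda>x. (min x 0)\<^sup>2) has_real_derivative 2 * x) (at x)"
      by (rule has_field_derivative_transform_within_open[of _ _ _ "{..<0}"]) (use 1 in auto)
    with 1 show ?thesis by simp
  next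
    case 2
    \<comment> \<open>For \<open>h \<noteq> 0\<close> the difference quotient
      \<open>(min h 0)\<^sup>2 / h\<close> equals \<open>min h 0\<close>.\<close>
    have "((\<lambda>h::real. min h 0) \<longlongrightarrow> min 0 0) (at 0)" by (intro tendsto_intros)
    then have "((\<lambda>h::real. (min h 0)\<^sup>2 / h) \<longlongrightarrow> 0) (at 0)"
      by (rule filterlim_cong[THEN iffD1, rotated -1])
        (auto simp: eventually_at_filter min_def power2_eq_square)
    with 2 show ?thesis by (simp add: DERIV_def)
  next
    case 3
    have "((\<lambda>x. 0) has_real_derivative 0) (at x)" by simp
    then have "((\<lambda>x. (min x 0)\<^sup>2) has_real_derivative 0) (at x)"
      by (rule has_field_derivative_transform_within_open[of _ _ _ "{0<..}"]) (use 3 in auto)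
    with 3 show ?thesis by simp
  qed
qed

lemma sum_periodic_shift:
  fixes f :: "nat \<Rightarrow> 'b::ab_group_add"
  assumes "f m = f 0"
  shows "(\<Sum>p<m. f (Suc p)) = (\<Sum>p<m. f p)"
proof -
  have "f 0 + (\<Sum>p<m. f (Suc p)) = (\<Sum>p<m. f p) + f m"
    using sum.lessThan_Suc_shift[of f m] sum.lessThan_Suc[of f m] by simp
  then show ?thesis using assms by (simp add: add.commute)
qed

lemma periodic_add_mult:
  assumes "\<And>p. y (p + m) = y (p::nat)"
  shows "y (p + k * m) = y p"
  by (induction k) (use assms[of "p + _ * m"] in \<open>simp_all add: add_ac\<close>)

text \<open>The cyclic families are indexed by all natural numbers; this reduces any index to its
  representative below \<open>m\<close>.\<close>

lemma periodic_mod: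
  assumes "\<And>p. y (p + m) = y (p::nat)"
  shows "y (p mod m) = y p"
  using periodic_add_mult[of y m "p mod m" "p div m", OF assms] by (simp add: mod_div_mult_eq)

text \<open>For \<open>N\<close> the sum of the squared negative parts, \<open>N' \<le> 2 N\<close> because
  \<open>2 y\<^sup>- z \<le> 2 y\<^sup>- z\<^sup>- \<le> (y\<^sup>-)\<^sup>2 + (z\<^sup>-)\<^sup>2\<close>, where \<open>x\<^sup>- = min x 0\<close>.\<close>

lemma cyclic_ode_nonneg:
  fixes y :: "nat \<Rightarrow> real \<Rightarrow> real"
  assumes D: "\<And>p t. t \<ge> 0 \<Longrightarrow> (y (Suc p) has_real_derivative y p t) (at t within {0..})"
    and per: "\<And>p. y (p + m) = y p" and "m > 0" and init: "\<And>p. y p 0 \<ge> 0" and "t \<ge> 0"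
  shows "y p t \<ge> 0"
proof -
  \<comment> \<open>The sum uses \<open>Suc p\<close> because derivatives are given at successor
    indices; a cyclic shift later turns it into the sum over \<open>p\<close>.\<close>
  define E where "E t = (\<Sum>p<m. (min (y (Suc p) t) 0)\<^sup>2)" for t
  define E' where "E' t = (\<Sum>p<m. 2 * min (y (Suc p) t) 0 * y p t)" for t
  have "E t \<le> E 0 * exp (2 * t)"
  proof (rule gronwall_exp[OF _ _ \<open>t \<ge> 0\<close>])
    fix s :: real assume "s \<ge> 0"
    show "(E has_real_derivative E' s) (at s within {0..})"
      unfolding E_def E'_def
      by (intro DERIV_sum DERIV_chain2[OF has_real_derivative_neg_part_square] D \<open>s \<ge> 0\<close>)
    have "2 * min a 0 * b \<le> (min a 0)\<^sup>2 + (min b 0)\<^sup>2" for a b :: real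
    proof -
      have "2 * min a 0 * b \<le> 2 * min a 0 * min b 0" by (intro mult_left_mono_neg) auto
      also have "\<dots> \<le> (min a 0)\<^sup>2 + (min b 0)\<^sup>2" by (rule sum_squares_bound)
      finally show ?thesis .
    qed
    then have "E' s \<le> (\<Sum>p<m. (min (y (Suc p) s) 0)\<^sup>2 + (min (y p s) 0)\<^sup>2)"
      unfolding E'_def by (intro sum_mono)
    also have "\<dots> = 2 * E s"
      using sum_periodic_shift[of "\<lambda>p. (min (y p s) 0)\<^sup>2" m] per[of 0] by (simp add: E_def sum.distrib)
    finally show "E' s \<le> 2 * E s" .
  qed
  moreover have "E 0 = 0" using init by (simp add: E_def)
  moreover have "E t = (\<Sum>p<m. (min (y p t) 0)\<^sup>2)"
    using sum_periodic_shift[of "\<lambda>p. (min (y p t) 0)\<^sup>2" m] per[of 0] by (simp add: E_def)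
  ultimately have "(\<Sum>p<m. (min (y p t) 0)\<^sup>2) = 0"
    by (intro antisym sum_nonneg) auto
  then have "(min (y (p mod m) t) 0)\<^sup>2 = 0"
    using \<open>m > 0\<close> by (subst (asm) sum_nonneg_eq_0_iff) auto
  then show ?thesis using periodic_mod[of y m p, OF per] by (simp add: min_def split: if_splits)
qed

text \<open>With mean zero, each value is the average of its differences to the others, hence
  bounded by the total variation \<open>D\<close>. Cauchy-Schwarz bounds \<open>D\<^sup>2\<close> by
  \<open>m\<close> times the sum of squared increments, and summation over \<open>p\<close> gives
  the second factor \<open>m\<close>.\<close>

lemma cycle_poincare:
  fixes g :: "nat \<Rightarrow> real"
  assumes "(\<Sum>p<m. g p) = 0"
  shows "(\<Sum>p<m. (g p)\<^sup>2) \<le> (real m)\<^sup>2 * (\<Sum>p<m. (g (Suc p) - g p)\<^sup>2)"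
proof -
  define D where "D = (\<Sum>r<m. \<bar>g (Suc r) - g r\<bar>)"
  have tele: "\<bar>g b - g a\<bar> \<le> D" if "a \<le> b" "b \<le> m" for a b
  proof -
    have "g b - g a = (\<Sum>r=a..<b. g (Suc r) - g r)" using sum_Suc_diff'[OF that(1), of g] by simp
    then have "\<bar>g b - g a\<bar> \<le> (\<Sum>r=a..<b. \<bar>g (Suc r) - g r\<bar>)" by simp
    also have "\<dots> \<le> D" unfolding D_def using that by (intro sum_mono2) auto
    finally show ?thesis .
  qed
  have "\<bar>g p\<bar> \<le> D" if "p < m" for p
  proof -
    have "real m * g p = (\<Sum>q<m. g p - g q)" using assms by (simp add: sum_subtractf)
    then have "real m * \<bar>g p\<bar> = \<bar>\<Sum>q<m. g p - g q\<bar>" by (metis abs_mult abs_of_nat)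
    also have "\<dots> \<le> (\<Sum>q<m. \<bar>g p - g q\<bar>)" by simp
    also have "\<dots> \<le> (\<Sum>q<m. D)"
      using tele that by (intro sum_mono) (metis abs_minus_commute lessThan_iff less_imp_le nat_le_linear)
    finally show ?thesis using that by simp
  qed
  then have "(g p)\<^sup>2 \<le> D\<^sup>2" if "p < m" for p using that by (metis abs_ge_zero power2_abs power_mono)
  then have "(\<Sum>p<m. (g p)\<^sup>2) \<le> (\<Sum>p<m. D\<^sup>2)" by (intro sum_mono) auto
  also have "\<dots> = real m * D\<^sup>2" by simp
  also have "\<dots> \<le> real m * ((\<Sum>r<m. \<bar>g (Suc r) - g r\<bar>\<^sup>2) * card {..<m})"
    unfolding D_def by (intro mult_left_mono sum_squared_le_sum_of_squares) simp
  finally show ?thesis by (simp add: power2_eq_square[of "real m"] mult_ac)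
qed

text \<open>The deviations \<open>g p\<close> from the mean have zero sum and satisfy
  \<open>g (Suc p)' = g p - g (Suc p)\<close>. The sum of their squares dissipates, and
  \<open>cycle_poincare\<close> turns this into decay at rate
  \<open>1 / (real m)\<^sup>2\<close>.\<close>

lemma cyclic_ode_equidistribution:
  fixes y :: "nat \<Rightarrow> real \<Rightarrow> real"
  assumes D: "\<And>p t. t \<ge> 0 \<Longrightarrow> (y (Suc p) has_real_derivative y p t) (at t within {0..})"
    and per: "\<And>p. y (p + m) = y p" and "m > 0" and "t \<ge> 0" and init: "\<And>p. \<bar>y p 0\<bar> \<le> K"
  shows "(exp (- t) * y p t - (\<Sum>p<m. y p 0) / m)\<^sup>2 \<le> 4 * real m * K\<^sup>2 * exp (- t / (real m)\<^sup>2)"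
proof -
  define S where "S = (\<Sum>p<m. y p 0)"
  define g where "g p t = exp (- t) * y p t - S / m" for p t
  have gper: "g (p + m) = g p" for p by (simp add: g_def per fun_eq_iff)
  have Dg: "(g (Suc p) has_real_derivative g p s - g (Suc p) s) (at s within {0..})" if "s \<ge> 0" for p s
    unfolding g_def by (rule derivative_eq_intros D[OF that] refl)+ (simp add: algebra_simps)
  have shift: "(\<Sum>p<m. \<phi> (g (Suc p) s)) = (\<Sum>p<m. \<phi> (g p s))" for \<phi> :: "real \<Rightarrow> real" and s
    using sum_periodic_shift[of "\<lambda>p. \<phi> (g p s)" m] gper[of 0] by simp
  have mean: "(\<Sum>p<m. g p s) = 0" if "s \<ge> 0" for s
  proof -
    have "((\<lambda>s. \<Sum>p<m. g (Suc p) s) has_real_derivative 0) (at s within {0..})" if "s \<ge> 0" for s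
    proof -
      have "((\<lambda>s. \<Sum>p<m. g (Suc p) s) has_real_derivative (\<Sum>p<m. g p s - g (Suc p) s)) (at s within {0..})"
        by (intro DERIV_sum Dg that)
      then show ?thesis using shift[of "\<lambda>x. x" s] by (simp add: sum_subtractf)
    qed
    then obtain c where c: "\<And>s. s \<in> {0..} \<Longrightarrow> (\<Sum>p<m. g (Suc p) s) = c"
      using has_field_derivative_zero_constant[of "{0..}" "\<lambda>s. \<Sum>p<m. g (Suc p) s"] by auto
    have "(\<Sum>p<m. g p 0) = 0" using \<open>m > 0\<close> by (simp add: g_def sum_subtractf S_def)
    with c[of 0] c[of s] shift[of "\<lambda>x. x"] that show ?thesis by simp
  qed
  define F where "F s = (\<Sum>p<m. (g (Suc p) s)\<^sup>2)" for s
  define F' where "F' s = (\<Sum>p<m. 2 * g (Suc p) s * (g p s - g (Suc p) s))" for s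
  have "F t \<le> F 0 * exp (- (1 / (real m)\<^sup>2) * t)"
  proof (rule gronwall_exp[OF _ _ \<open>t \<ge> 0\<close>])
    fix s :: real assume s: "s \<ge> 0"
    show "(F has_real_derivative F' s) (at s within {0..})"
      unfolding F_def F'_def by (rule derivative_eq_intros Dg s refl)+ (simp add: mult_ac)
    \<comment> \<open>With \<open>a = g p s\<close> and \<open>b = g (Suc p) s\<close> this is
      \<open>2 * b * (a - b) = a^2 - b^2 - (b - a)^2\<close>; the first two squares cancel around
      the cycle.\<close>
    have "F' s = (\<Sum>p<m. (g p s)\<^sup>2 - (g (Suc p) s)\<^sup>2 - (g (Suc p) s - g p s)\<^sup>2)"
      unfolding F'_def by (intro sum.cong) (auto simp: power2_eq_square algebra_simps)
    also have "\<dots> = - (\<Sum>p<m. (g (Suc p) s - g p s)\<^sup>2)"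
      using shift[of "\<lambda>x. x\<^sup>2" s] by (simp add: sum_subtractf)
    finally have "(real m)\<^sup>2 * F' s \<le> - (\<Sum>p<m. (g p s)\<^sup>2)"
      using cycle_poincare[where g="\<lambda>p. g p s", OF mean[OF s]] by simp
    also have "\<dots> = - F s" using shift[of "\<lambda>x. x\<^sup>2" s] by (simp add: F_def)
    finally show "F' s \<le> - (1 / (real m)\<^sup>2) * F s" using \<open>m > 0\<close> by (simp add: field_simps)
  qed
  \<comment> \<open>Initial values and their mean are at most \<open>K\<close> in absolute value, so
    each of the \<open>m\<close> deviations is at most \<open>2 * K\<close>.\<close>
  moreover have "F 0 \<le> 4 * real m * K\<^sup>2"
  proof -
    have "\<bar>S\<bar> \<le> (\<Sum>p<m. K)" unfolding S_def by (rule order_trans[OF sum_abs sum_mono[OF init]])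
    then have "\<bar>S / m\<bar> \<le> K" using \<open>m > 0\<close> by (simp add: field_simps)
    then have "\<bar>g p 0\<bar> \<le> 2 * K" for p using init[of p] unfolding g_def by (simp del: abs_divide)
    then have "(g p 0)\<^sup>2 \<le> (2 * K)\<^sup>2" for p by (metis abs_ge_zero power2_abs power_mono)
    then have "F 0 \<le> (\<Sum>p<m. (2 * K)\<^sup>2)" unfolding F_def by (intro sum_mono)
    then show ?thesis by simp
  qed
  ultimately have "F t \<le> 4 * real m * K\<^sup>2 * exp (- (1 / (real m)\<^sup>2) * t)"
    by (meson exp_ge_zero mult_right_mono order_trans)
  then have "F t \<le> 4 * real m * K\<^sup>2 * exp (- t / (real m)\<^sup>2)" by simp
  moreover have "(g (p mod m) t)\<^sup>2 \<le> (\<Sum>p<m. (g p t)\<^sup>2)"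
    using \<open>m > 0\<close> by (intro member_le_sum) auto
  moreover have "(\<Sum>p<m. (g p t)\<^sup>2) = F t" using shift[of "\<lambda>x. x\<^sup>2" t] by (simp add: F_def)
  ultimately show ?thesis
    using periodic_mod[of g m p, OF gper] by (simp add: g_def S_def)
qed

section \<open>Powers and flow of an orthogonal map\<close>

lemma orthogonal_transformation_funpow:
  fixes A :: "'a::real_inner \<Rightarrow> 'a"
  assumes "orthogonal_transformation A"
  shows "orthogonal_transformation (A ^^ p)"
proof (induction p)
  case 0
  show ?case by (simp add: orthogonal_transformation_def id_def linear_iff)
next
  case (Suc p)
  then show ?case using orthogonal_transformation_compose[OF assms] by (simp add: o_def)
qed

text \<open>The curve \<open>c\<close> is \<open>exp (t A) c\<^sub>0\<close>; the derivative is \<open>A c\<close> tested against \<open>A u\<close>.\<close>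

lemma orthogonal_flow:
  fixes A :: "'a::euclidean_space \<Rightarrow> 'a"
  assumes "orthogonal_transformation A"
  obtains c where "c 0 = c0"
    "\<And>t u. ((\<lambda>t. A u \<bullet> c t) has_real_derivative u \<bullet> c t) (at t)"
proof -
  \<comment> \<open>Powers of \<open>A\<close> preserve \<open>norm c0\<close>, so this exponential
    series is dominated by that of \<open>exp \<bar>t\<bar>\<close> times
    \<open>norm c0\<close>.\<close>
  define c where "c t = (\<Sum>k. (t ^ k / fact k) *\<^sub>R (A ^^ k) c0)" for t :: real
  have norm: "norm ((A ^^ k) c0) = norm c0" for k
    using orthogonal_transformation_funpow[OF assms] by (rule orthogonal_transformation_norm)
  have summ: "summable (\<lambda>k. (t ^ k / fact k) *\<^sub>R (A ^^ k) c0)" for t :: real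
  proof (rule summable_norm_cancel, rule summable_cong[THEN iffD1])
    show "summable (\<lambda>k. (inverse (fact k) * \<bar>t\<bar> ^ k) * norm c0)"
      by (intro summable_mult2 summable_exp)
    show "\<forall>\<^sub>F k in sequentially. (inverse (fact k) * \<bar>t\<bar> ^ k) * norm c0 = norm ((t ^ k / fact k) *\<^sub>R (A ^^ k) c0)"
      by (simp add: norm power_abs divide_inverse abs_mult mult_ac)
  qed
  define a where "a u k = (u \<bullet> (A ^^ k) c0) / fact k" for u k
  have sums: "(\<lambda>k. a u k * t ^ k) sums (u \<bullet> c t)" for u t
  proof -
    have "(\<lambda>k. u \<bullet> ((t ^ k / fact k) *\<^sub>R (A ^^ k) c0)) sums (u \<bullet> c t)"
      unfolding c_def by (intro bounded_linear.sums[OF bounded_linear_inner_right] summable_sums summ)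
    then show ?thesis by (simp add: a_def mult_ac)
  qed
  \<comment> \<open>Orthogonality strips one \<open>A\<close> from both arguments of the inner
    product, and the factor \<open>Suc k\<close> in \<open>diffs\<close> lowers the
    factorial.\<close>
  have diffs: "diffs (a (A u)) = a u" for u
    using assms
    by (simp add: diffs_def a_def fun_eq_iff orthogonal_transformation_def)
  show ?thesis
  proof (rule that[of c])
    \<comment> \<open>Only the term \<open>k = 0\<close> survives, with
      \<open>0 ^ 0 = 1\<close>.\<close>
    have "c 0 = (\<Sum>k. if k = 0 then c0 else 0)"
      unfolding c_def by (intro suminf_cong) auto
    then show "c 0 = c0" using suminf_finite[of "{0}" "\<lambda>k. if k = 0 then c0 else 0"] by simp
    fix t u
    have "((\<lambda>t. \<Sum>k. a (A u) k * t ^ k) has_real_derivative (\<Sum>k. diffs (a (A u)) k * t ^ k)) (at t)"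
      using sums by (intro termdiffs_strong_converges_everywhere) (blast intro: sums_summable)
    then show "((\<lambda>t. A u \<bullet> c t) has_real_derivative u \<bullet> c t) (at t)"
      using sums[THEN sums_unique] diffs by simp
  qed
qed

section \<open>Solutions of the Hukuhara equation\<close>

text \<open>Support functions turn Hukuhara differences into differences of reals, so the set
  quotients become difference quotients whose error is controlled by the Hausdorff distance.\<close>

lemma support_has_derivative:
  fixes X :: "real \<Rightarrow> 'a::euclidean_space set"
  assumes D: "has_hukuhara_derivative X D t" and X: "\<And>s. s \<ge> 0 \<Longrightarrow> X s \<in> conv_sets" and "t \<ge> 0"
  shows "((\<lambda>s. support (X s) u) has_real_derivative support D u) (at t within {0..})"
proof -
  have cD: "D \<in> conv_sets" using D by (simp add: has_hukuhara_derivative_def)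
  \<comment> \<open>Stated for general \<open>P\<close> and \<open>Q\<close> to cover both the
    forward and the backward quotient.\<close>
  have quot: "((\<lambda>h. (support (P h) u - support (Q h) u) / h) \<longlongrightarrow> support D u) (at_right 0)"
    if ex: "\<forall>\<^sub>F h in at_right 0. hukuhara_diff_exists (P h) (Q h)"
      and lim: "((\<lambda>h. hausdist ((*\<^sub>R) (inverse h) ` hukuhara_diff (P h) (Q h)) D) \<longlongrightarrow> 0) (at_right 0)"
      and Q: "\<forall>\<^sub>F h in at_right 0. Q h \<in> conv_sets"
    for P Q :: "real \<Rightarrow> 'a set"
  proof -
    let ?H = "\<lambda>h. hausdist ((*\<^sub>R) (inverse h) ` hukuhara_diff (P h) (Q h)) D"
    have "\<forall>\<^sub>F h in at_right 0. norm ((support (P h) u - support (Q h) u) / h - support D u) \<le> ?H h * norm u"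
      using ex Q eventually_at_right_less[of 0]
    proof eventually_elim
      case (elim h)
      then obtain Z where Z: "Z \<in> conv_sets" "P h = Q h + Z" by (auto simp: hukuhara_diff_exists_def)
      have "hukuhara_diff (P h) (Q h) = Z" using elim(2) Z by (rule hukuhara_diff_eq)
      moreover have "(support (P h) u - support (Q h) u) / h = support ((*\<^sub>R) (inverse h) ` Z) u"
        using elim Z by (simp add: support_plus support_scaleR divide_inverse)
      ultimately show ?case
        using support_diff_le_hausdist[OF conv_sets_scaleR[OF Z(1)] cD] by simp
    qed
    moreover have "((\<lambda>h. ?H h * norm u) \<longlongrightarrow> 0) (at_right 0)" using lim by (rule tendsto_mult_left_zero)
    ultimately have "((\<lambda>h. (support (P h) u - support (Q h) u) / h - support D u) \<longlongrightarrow> 0) (at_right 0)"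
      by (rule Lim_null_comparison)
    then show ?thesis by (rule LIM_zero_cancel)
  qed
  let ?f = "\<lambda>s. support (X s) u"
  have "((\<lambda>h. (?f (t + h) - ?f t) / h) \<longlongrightarrow> support D u) (at_right 0)"
    using D X[OF \<open>t \<ge> 0\<close>] by (intro quot) (auto simp: has_hukuhara_derivative_def)
  then have right: "(?f has_real_derivative support D u) (at_right t)"
    unfolding has_field_derivative_iff
    by (subst at_right_to_0) (simp add: filterlim_filtermap add.commute)
  show ?thesis
  proof (cases "t = 0")
    case True
    have "at 0 within {0..} = at_right (0::real)"
      unfolding at_within_def by (rule arg_cong[where f = "\<lambda>S. inf _ (principal S)"]) auto
    with right True show ?thesis by simp
  next
    case False
    with \<open>t \<ge> 0\<close> have "t > 0" by simp
    \<comment> \<open>Membership in \<open>conv_sets\<close> is assumed at nonnegative times, so the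
      backward quotient is considered for \<open>h < t\<close>.\<close>
    have "\<forall>\<^sub>F h in at_right 0. h < t" using \<open>t > 0\<close> by (simp add: eventually_at_right_field) blast
    then have "\<forall>\<^sub>F h in at_right 0. X (t - h) \<in> conv_sets"
      by eventually_elim (simp add: X)
    then have "((\<lambda>h. (?f t - ?f (t - h)) / h) \<longlongrightarrow> support D u) (at_right 0)"
      using D \<open>t > 0\<close> by (intro quot) (auto simp: has_hukuhara_derivative_def)
    \<comment> \<open>Substituting \<open>- h\<close> for \<open>h\<close> turns the backward
      quotient into the left one.\<close>
    then have "((\<lambda>h. (?f (t + h) - ?f t) / h) \<longlongrightarrow> support D u) (at_left 0)"
      by (subst at_left_minus) (simp add: filterlim_filtermap minus_divide_left del: divide_minus_left)
    then have "(?f has_real_derivative support D u) (at_left t)"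
      unfolding has_field_derivative_iff
      by (subst at_left_to_0) (simp add: filterlim_filtermap add.commute)
    with right have "(?f has_real_derivative support D u) (at t)"
      unfolding has_field_derivative_iff by (simp add: filterlim_at_split)
    then show ?thesis by (rule has_field_derivative_at_within)
  qed
qed

lemma funpow_add_period:
  assumes "A ^^ m = id"
  shows "(A ^^ (p + m)) v = (A ^^ p) v"
  using assms by (simp add: funpow_add)

lemma hukuhara_solution_conv_sets: "hukuhara_solution A X0 X \<Longrightarrow> t \<ge> 0 \<Longrightarrow> X t \<in> conv_sets"
  by (simp add: hukuhara_solution_def)

text \<open>For \<open>v = (A ^^ p) u\<close> this is the cyclic system satisfied by the support
  values along the powers of \<open>A\<close>.\<close>

lemma hukuhara_solution_support_derivative:
  assumes "orthogonal_transformation A" "hukuhara_solution A X0 X" "t \<ge> 0"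
  shows "((\<lambda>t. support (X t) (A v)) has_real_derivative support (X t) v) (at t within {0..})"
proof -
  have "((\<lambda>t. support (X t) (A v)) has_real_derivative support (A ` X t) (A v)) (at t within {0..})"
    using assms(2,3) by (intro support_has_derivative) (auto simp: hukuhara_solution_def)
  then show ?thesis by (simp add: support_orthogonal_image[OF assms(1)])
qed

text \<open>Comparison principle: \<open>exp t\<close> and \<open>u \<bullet> c t\<close> solve the same linear system as the support functions.\<close>

lemma hukuhara_solution_comparison:
  fixes A :: "'a::euclidean_space \<Rightarrow> 'a"
  assumes A: "orthogonal_transformation A" and "m > 0" and Am: "A ^^ m = id"
    and X: "hukuhara_solution A X0 X" and Y: "hukuhara_solution A Y0 Y"
    and c: "\<And>t u. ((\<lambda>t. A u \<bullet> c t) has_real_derivative u \<bullet> c t) (at t)"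
    and init: "\<And>u. a * support X0 u + b * support Y0 u + u \<bullet> c 0 + k * norm u \<ge> 0"
    and "t \<ge> 0"
  shows "a * support (X t) u + b * support (Y t) u + u \<bullet> c t + k * exp t * norm u \<ge> 0"
proof -
  \<comment> \<open>The term with \<open>norm u\<close> is the same for every \<open>p\<close>, as
    powers of \<open>A\<close> preserve norms; since \<open>exp\<close> is its own derivative, it
    solves the cyclic system too.\<close>
  define y where "y p t = a * support (X t) ((A ^^ p) u) + b * support (Y t) ((A ^^ p) u)
    + (A ^^ p) u \<bullet> c t + k * exp t * norm u" for p t
  have "y 0 t \<ge> 0"
  proof (rule cyclic_ode_nonneg[OF _ _ \<open>m > 0\<close> _ \<open>t \<ge> 0\<close>])
    show "y (p + m) = y p" for p by (simp add: y_def funpow_add_period[OF Am] fun_eq_iff)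
    have "norm ((A ^^ p) u) = norm u" for p
      using orthogonal_transformation_funpow[OF A] by (rule orthogonal_transformation_norm)
    then show "y p 0 \<ge> 0" for p
      using init[of "(A ^^ p) u"] X Y by (simp add: y_def hukuhara_solution_def)
    fix p and s :: real assume s: "s \<ge> 0"
    show "(y (Suc p) has_real_derivative y p s) (at s within {0..})"
      unfolding y_def funpow.simps comp_apply
      by (rule derivative_eq_intros hukuhara_solution_support_derivative[OF A X s]
          hukuhara_solution_support_derivative[OF A Y s] has_field_derivative_at_within[OF c] refl)+ simp
  qed
  then show ?thesis by (simp add: y_def)
qed

text \<open>The comparison principle carries the inner and outer ball of \<open>X0\<close> along:
  their centre follows the flow of \<open>A\<close> and their radii grow like \<open>exp t\<close>,
  so the ratio \<open>R / r\<close> is constant in time.\<close>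

lemma hukuhara_solution_support_bounds:
  fixes A :: "'a::euclidean_space \<Rightarrow> 'a"
  assumes A: "orthogonal_transformation A" "m > 0" "A ^^ m = id"
    and X: "hukuhara_solution A X0 X" and "X0 \<in> conv_bodies"
  obtains y r R where "r > 0" "R > 0"
    "\<And>t u. t \<ge> 0 \<Longrightarrow> r * exp t * norm u \<le> support (X t) u - u \<bullet> y t"
    "\<And>t u. t \<ge> 0 \<Longrightarrow> support (X t) u - u \<bullet> y t \<le> R * exp t * norm u"
proof -
  obtain x r R where r: "r > 0" "R > 0" "\<And>u. r * norm u \<le> support X0 u - u \<bullet> x"
    "\<And>u. support X0 u - u \<bullet> x \<le> R * norm u"
    using conv_bodies_support_bounds[OF assms(5)] by metis
  obtain c where c: "c 0 = x" "\<And>t u. ((\<lambda>t. A u \<bullet> c t) has_real_derivative u \<bullet> c t) (at t)"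
    using orthogonal_flow[OF A(1)] by metis
  have c': "((\<lambda>t. A u \<bullet> (- c t)) has_real_derivative u \<bullet> (- c t)) (at t)" for t u
    using DERIV_minus[OF c(2)] by simp
  show ?thesis
  proof (rule that[OF r(1,2)])
    fix t :: real and u :: 'a assume t: "t \<ge> 0"
    \<comment> \<open>The second solution slot is filled by \<open>X\<close> itself with coefficient
      0; the signs select comparison with the inner or the outer ball.\<close>
    show "r * exp t * norm u \<le> support (X t) u - u \<bullet> c t"
      using hukuhara_solution_comparison[OF A X X c', of 1 0 "- r" t u] t r(3) c(1) by simp
    show "support (X t) u - u \<bullet> c t \<le> R * exp t * norm u"
      using hukuhara_solution_comparison[OF A X X c(2), of "-1" 0 R t u] t r(4) c(1)
      by (simp add: algebra_simps)
  qed
qed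

lemma hukuhara_solution_conv_bodies:
  fixes A :: "'a::euclidean_space \<Rightarrow> 'a"
  assumes "orthogonal_transformation A" "m > 0" "A ^^ m = id"
    and X: "hukuhara_solution A X0 X" and "X0 \<in> conv_bodies" and "t \<ge> 0"
  shows "X t \<in> conv_bodies"
proof -
  obtain y r R where "r > 0" "\<And>t u. t \<ge> 0 \<Longrightarrow> r * exp t * norm u \<le> support (X t) u - u \<bullet> y t"
    using hukuhara_solution_support_bounds[OF assms(1-5)] by metis
  then show ?thesis
    using hukuhara_solution_conv_sets[OF X] \<open>t \<ge> 0\<close> by (intro conv_bodies_if_support_ge[of _ "r * exp t" "y t"]) auto
qed

section \<open>Stability of orbits\<close>

text \<open>The error bound and the inner radius both grow like \<open>exp t\<close>, so their
  quotient keeps its initial value and \<open>body_dist_le_support\<close> applies at all times with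
  the same \<open>q\<close>.\<close>

lemma conv_bodies_orbit_stability:
  fixes A :: "'a::euclidean_space \<Rightarrow> 'a"
  assumes A: "orthogonal_transformation A" "m > 0" "A ^^ m = id"
    and Y: "hukuhara_solution A Y0 Y" "Y0 \<in> conv_bodies" and "e > 0"
  shows "\<exists>d>0. \<forall>X0\<in>conv_bodies. rho (orbit X0) (orbit Y0) < d \<longrightarrow>
    (\<forall>X. hukuhara_solution A X0 X \<longrightarrow> (\<forall>t\<ge>0. rho (orbit (X t)) (orbit (Y t)) < e))"
proof -
  obtain y r R where r: "r > 0" "R > 0"
    "\<And>t u. t \<ge> 0 \<Longrightarrow> r * exp t * norm u \<le> support (Y t) u - u \<bullet> y t"
    "\<And>t u. t \<ge> 0 \<Longrightarrow> support (Y t) u - u \<bullet> y t \<le> R * exp t * norm u"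
    using hukuhara_solution_support_bounds[OF A Y] by metis
  define \<kappa> where "\<kappa> = vol_radius (cball (0::'a) 1)"
  have "\<kappa> > 0" unfolding \<kappa>_def by (rule vol_radius_unit_ball_pos)
  define b where "b = vol_radius Y0"
  have "b > 0"
  proof -
    have "r * \<kappa> \<le> b"
      unfolding b_def \<kappa>_def using Y r(1) r(3)[of 0]
      by (intro vol_radius_ge_if_support_ge[of _ _ "y 0"]) (auto simp: conv_bodies_def hukuhara_solution_def)
    then show ?thesis using r(1) \<open>\<kappa> > 0\<close> by (smt (verit) mult_pos_pos)
  qed
  define L where "L = 2 / \<kappa> * (1 + R / r)"
  have "L > 0" using \<open>\<kappa> > 0\<close> r(1,2) unfolding L_def by (intro mult_pos_pos add_pos_pos divide_pos_pos) auto
  \<comment> \<open>The cap 1/2 meets the hypothesis of \<open>body_dist_le_support\<close>, and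
    \<open>e / (2 * L)\<close> keeps the resulting bound \<open>q * L\<close> strictly below
    \<open>e\<close>.\<close>
  define q where "q = min (1/2) (e / (2 * L))"
  have q: "0 < q" "q \<le> 1/2" using \<open>e > 0\<close> \<open>L > 0\<close> by (auto simp: q_def)
  have qL: "q * L < e"
  proof -
    have "q * L \<le> e / (2 * L) * L" using \<open>L > 0\<close> by (intro mult_right_mono) (auto simp: q_def)
    then show ?thesis using \<open>L > 0\<close> \<open>e > 0\<close> by simp
  qed
  \<comment> \<open>Chosen so that the error \<open>d * b * l\<close> from
    \<open>support_close_if_body_dist_less\<close> equals \<open>q * l * r\<close>.\<close>
  define d where "d = q * r / b"
  show ?thesis
  proof (intro exI[of _ d] conjI ballI impI allI)
    show "d > 0" using q r(1) \<open>b > 0\<close> by (simp add: d_def)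
    fix X0 X and t :: real
    assume X0: "X0 \<in> conv_bodies" and "rho (orbit X0) (orbit Y0) < d" and X: "hukuhara_solution A X0 X" and t: "t \<ge> 0"
    then have "body_dist X0 Y0 < d" using Y by (simp add: rho_orbit)
    then obtain l c0 where l: "l > 0"
      and c0: "\<And>u. \<bar>support X0 u - l * support Y0 u - u \<bullet> c0\<bar> \<le> d * b * l * norm u"
      using support_close_if_body_dist_less[OF X0 Y(2)] unfolding b_def by metis
    have db: "d * b * l = q * l * r" using \<open>b > 0\<close> by (simp add: d_def)
    obtain c where c: "c 0 = c0" "\<And>t u. ((\<lambda>t. A u \<bullet> c t) has_real_derivative u \<bullet> c t) (at t)"
      using orthogonal_flow[OF A(1)] by metis
    have c': "((\<lambda>t. A u \<bullet> (- c t)) has_real_derivative u \<bullet> (- c t)) (at t)" for t u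
      using DERIV_minus[OF c(2)] by simp
    have i: "1 * support X0 u + - l * support Y0 u + u \<bullet> - c 0 + (q * l * r) * norm u \<ge> 0"
      "- 1 * support X0 u + l * support Y0 u + u \<bullet> c 0 + (q * l * r) * norm u \<ge> 0" for u
      using c0[of u] unfolding db c(1) by (auto simp: abs_le_iff)
    have close: "\<bar>support (X t) u - l * support (Y t) u - u \<bullet> c t\<bar> \<le> q * l * (r * exp t) * norm u" for u
      using hukuhara_solution_comparison[OF A X Y(1) c' i(1) t, of u]
        hukuhara_solution_comparison[OF A X Y(1) c(2) i(2) t, of u]
      by (simp add: abs_le_iff mult.assoc)
    have "body_dist (X t) (Y t) \<le> 2 * q / \<kappa> * (1 + (R * exp t) / (r * exp t))"
      unfolding \<kappa>_def
      by (rule body_dist_le_support[where y = "y t" and c = "c t" and l = l])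
        (use close r t q l hukuhara_solution_conv_sets[OF X t] hukuhara_solution_conv_sets[OF Y(1) t] in auto)
    also have "\<dots> = q * L" by (simp add: L_def)
    finally show "rho (orbit (X t)) (orbit (Y t)) < e"
      using qL hukuhara_solution_conv_bodies[OF A X X0 t] hukuhara_solution_conv_bodies[OF A Y t]
      by (simp add: rho_orbit)
  qed
qed

section \<open>Attractivity under the orbit condition\<close>

lemma conv_sets_orthogonal_power:
  fixes A :: "'a::euclidean_space \<Rightarrow> 'a"
  assumes "orthogonal_transformation A" "X \<in> conv_sets"
  shows "(A ^^ p) ` X \<in> conv_sets"
  using orthogonal_transformation_funpow[OF assms(1)] assms(2)
  by (intro conv_sets_linear_image) (auto simp: orthogonal_transformation_def)

text \<open>Moving \<open>A ^^ p\<close> from the set to the direction produces its inverse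
  \<open>A ^^ (m - p)\<close>; over a full period the exponents are merely permuted.\<close>

lemma support_sum_orthogonal_powers:
  fixes A :: "'a::euclidean_space \<Rightarrow> 'a"
  assumes A: "orthogonal_transformation A" "A ^^ m = id" and X: "X \<in> conv_sets"
  shows "support (\<Sum>p<m. (A ^^ p) ` X) v = (\<Sum>p<m. support X ((A ^^ p) v))"
proof -
  have "support (\<Sum>p<m. (A ^^ p) ` X) v = (\<Sum>p<m. support ((A ^^ p) ` X) v)"
    by (intro support_sum conv_sets_orthogonal_power A(1) X)
  \<comment> \<open>For \<open>p < m\<close> the exponent is \<open>m - p\<close>, written in the
    form that \<open>sum.nat_diff_reindex\<close> reverses.\<close>
  also have "\<dots> = (\<Sum>p<m. support X ((A ^^ Suc (m - Suc p)) v))"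
  proof (rule sum.cong)
    fix p assume "p \<in> {..<m}"
    then have "(A ^^ p) ((A ^^ Suc (m - Suc p)) v) = (A ^^ (p + Suc (m - Suc p))) v"
      and "p + Suc (m - Suc p) = m" by (simp_all only: funpow_add comp_apply lessThan_iff)
    then have "(A ^^ p) ((A ^^ Suc (m - Suc p)) v) = v" using A(2) by (simp only: id_apply)
    then show "support ((A ^^ p) ` X) v = support X ((A ^^ Suc (m - Suc p)) v)"
      using support_orthogonal_image[OF orthogonal_transformation_funpow[OF A(1)]] by metis
  qed simp
  also have "\<dots> = (\<Sum>p<m. support X ((A ^^ Suc p) v))"
    by (rule sum.nat_diff_reindex)
  also have "\<dots> = (\<Sum>p<m. support X ((A ^^ p) v))"
    by (rule sum_periodic_shift) (simp add: A(2))
  finally show ?thesis .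
qed

text \<open>The orbit condition makes the cyclic mean of \<open>support X0 - l * support Y0\<close>
  the linear functional \<open>u \<bullet> b / m\<close>. A linear functional amounts to a
  translation, which \<open>body_dist\<close> ignores, and the remainder is negligible against
  \<open>exp t\<close>.\<close>

lemma conv_bodies_orbit_attractivity:
  fixes A :: "'a::euclidean_space \<Rightarrow> 'a"
  assumes A: "orthogonal_transformation A" "m > 0" "A ^^ m = id"
    and Y: "hukuhara_solution A Y0 Y" "Y0 \<in> conv_bodies"
    and X: "hukuhara_solution A X0 X" "X0 \<in> conv_bodies"
    and orb: "(\<Sum>p<m. (A ^^ p) ` X0) \<in> orbit (\<Sum>p<m. (A ^^ p) ` Y0)"
  shows "((\<lambda>t. rho (orbit (X t)) (orbit (Y t))) \<longlongrightarrow> 0) at_top"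
proof -
  obtain y r R where r: "r > 0" "R > 0"
    "\<And>t u. t \<ge> 0 \<Longrightarrow> r * exp t * norm u \<le> support (Y t) u - u \<bullet> y t"
    "\<And>t u. t \<ge> 0 \<Longrightarrow> support (Y t) u - u \<bullet> y t \<le> R * exp t * norm u"
    using hukuhara_solution_support_bounds[OF A Y] by metis
  have cX: "X0 \<in> conv_sets" and cY: "Y0 \<in> conv_sets" using X Y by (auto simp: conv_bodies_def)
  obtain l b where l: "l > 0" and lb: "(\<Sum>p<m. (A ^^ p) ` X0) = (\<lambda>x. l *\<^sub>R x + b) ` (\<Sum>p<m. (A ^^ p) ` Y0)"
    using orb by (auto simp: orbit_def homotheties_def)
  have cYs: "(\<Sum>p<m. (A ^^ p) ` Y0) \<in> conv_sets"
    by (intro conv_sets_sum conv_sets_orthogonal_power A(1) cY)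
  have sum_eq: "(\<Sum>p<m. support X0 ((A ^^ p) v)) = l * (\<Sum>p<m. support Y0 ((A ^^ p) v)) + v \<bullet> b" for v
    using arg_cong[OF lb, of "\<lambda>Z. support Z v"] l
    by (simp add: support_homothety[OF cYs] support_sum_orthogonal_powers[OF A(1,3)] cX cY)
  \<comment> \<open>Comparison with the singleton of the origin, whose support function
    vanishes.\<close>
  have "\<exists>K. \<forall>u. \<bar>support Z u\<bar> \<le> K * norm u" if "Z \<in> conv_sets" for Z :: "'a set"
    using support_diff_le_hausdist[OF that conv_sets_singleton[of 0]] by (auto simp: support_def)
  then obtain KX KY where KX: "\<And>u. \<bar>support X0 u\<bar> \<le> KX * norm u" and KY: "\<And>u. \<bar>support Y0 u\<bar> \<le> KY * norm u"
    using cX cY by metis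
  define K where "K = KX + l * KY"
  \<comment> \<open>The square root undoes the squared estimate of
    \<open>cyclic_ode_equidistribution\<close>, which also halves the decay exponent.\<close>
  define C where "C = sqrt (4 * real m * K\<^sup>2)"
  have close: "\<bar>support (X t) u - l * support (Y t) u - u \<bullet> ((exp t / m) *\<^sub>R b)\<bar>
      \<le> C * exp (- t / (2 * (real m)\<^sup>2)) * exp t * norm u" if t: "t \<ge> 0" for t u
  proof -
    define z where "z p t = support (X t) ((A ^^ p) u) - l * support (Y t) ((A ^^ p) u)" for p t
    have "(exp (- t) * z 0 t - (\<Sum>p<m. z p 0) / m)\<^sup>2 \<le> 4 * real m * (K * norm u)\<^sup>2 * exp (- t / (real m)\<^sup>2)"
    proof (rule cyclic_ode_equidistribution[OF _ _ A(2) t])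
      show "z (p + m) = z p" for p by (simp add: z_def funpow_add_period[OF A(3)] fun_eq_iff)
      show "(z (Suc p) has_real_derivative z p s) (at s within {0..})" if "s \<ge> 0" for p s
        unfolding z_def funpow.simps comp_apply
        by (rule derivative_eq_intros hukuhara_solution_support_derivative[OF A(1) X(1) that]
            hukuhara_solution_support_derivative[OF A(1) Y(1) that] refl)+ simp
      show "\<bar>z p 0\<bar> \<le> K * norm u" for p
      proof -
        have "norm ((A ^^ p) u) = norm u"
          using orthogonal_transformation_funpow[OF A(1)] by (rule orthogonal_transformation_norm)
        then have 1: "\<bar>support X0 ((A ^^ p) u)\<bar> \<le> KX * norm u" and 2: "\<bar>support Y0 ((A ^^ p) u)\<bar> \<le> KY * norm u"
          using KX[of "(A ^^ p) u"] KY[of "(A ^^ p) u"] by auto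
        have "\<bar>l * support Y0 ((A ^^ p) u)\<bar> \<le> l * (KY * norm u)"
          using 2 l by (simp add: abs_mult)
        with 1 show ?thesis
          using X(1) Y(1) by (simp add: z_def hukuhara_solution_def K_def algebra_simps)
      qed
    qed
    also have "\<dots> = (C * exp (- t / (2 * (real m)\<^sup>2)) * norm u)\<^sup>2"
    proof -
      have "C\<^sup>2 = 4 * real m * K\<^sup>2" by (simp add: C_def)
      moreover have "(exp (- t / (2 * (real m)\<^sup>2)))\<^sup>2 = exp (- t / (real m)\<^sup>2)"
        by (simp flip: exp_double)
      ultimately show ?thesis by (simp add: power_mult_distrib)
    qed
    finally have "\<bar>exp (- t) * z 0 t - (\<Sum>p<m. z p 0) / m\<bar> \<le> C * exp (- t / (2 * (real m)\<^sup>2)) * norm u"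
      by (rule abs_le_square_iff[THEN iffD2, THEN order_trans]) (simp add: C_def)
    moreover have "(\<Sum>p<m. z p 0) = u \<bullet> b"
      using sum_eq[of u] X(1) Y(1) by (simp add: z_def hukuhara_solution_def sum_subtractf flip: sum_distrib_left)
    ultimately have "exp t * \<bar>exp (- t) * z 0 t - u \<bullet> b / m\<bar> \<le> exp t * (C * exp (- t / (2 * (real m)\<^sup>2)) * norm u)"
      by simp
    moreover have "exp t * \<bar>exp (- t) * z 0 t - u \<bullet> b / m\<bar> = \<bar>exp t * (exp (- t) * z 0 t - u \<bullet> b / m)\<bar>"
      by (simp add: abs_mult)
    moreover have "exp t * (exp (- t) * z 0 t - u \<bullet> b / m) = z 0 t - u \<bullet> ((exp t / m) *\<^sub>R b)"
      by (simp add: right_diff_distrib exp_minus)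
    ultimately have "\<bar>z 0 t - u \<bullet> ((exp t / m) *\<^sub>R b)\<bar> \<le> exp t * (C * exp (- t / (2 * (real m)\<^sup>2)) * norm u)"
      by (simp only:)
    then show ?thesis by (simp add: z_def mult_ac)
  qed
  define \<kappa> where "\<kappa> = vol_radius (cball (0::'a) 1)"
  \<comment> \<open>Division by \<open>l * r\<close> makes the error relative, giving
    \<open>close\<close> the form expected by \<open>body_dist_le_support\<close>.\<close>
  define q where "q t = C * exp (- t / (2 * (real m)\<^sup>2)) / (l * r)" for t
  have "C \<ge> 0" by (simp add: C_def)
  have "filterlim (\<lambda>t. inverse (2 * (real m)\<^sup>2) * t) at_top at_top"
    using \<open>m > 0\<close> by (intro filterlim_tendsto_pos_mult_at_top[OF tendsto_const] filterlim_ident) simp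
  then have "((\<lambda>t. exp (- (inverse (2 * (real m)\<^sup>2) * t))) \<longlongrightarrow> 0) at_top"
    by (intro filterlim_compose[OF exp_at_bot] filterlim_compose[OF filterlim_uminus_at_bot_at_top])
  then have "((\<lambda>t. exp (- t / (2 * (real m)\<^sup>2))) \<longlongrightarrow> 0) at_top" by (simp add: field_simps)
  then have q0: "(q \<longlongrightarrow> 0) at_top"
    unfolding q_def by (intro tendsto_divide_zero tendsto_mult_right_zero)
  \<comment> \<open>The estimate of \<open>body_dist_le_support\<close> requires
    \<open>q t \<le> 1/2\<close>, which is thus secured for all large \<open>t\<close>.\<close>
  have "\<forall>\<^sub>F t in at_top. q t < 1/2" using q0 by (rule order_tendstoD) simp
  then have bound: "\<forall>\<^sub>F t in at_top. norm (rho (orbit (X t)) (orbit (Y t))) \<le> q t * (2 / \<kappa> * (1 + R / r))"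
    using eventually_ge_at_top[of 0]
  proof eventually_elim
    case (elim t)
    have q: "q t \<ge> 0" using \<open>C \<ge> 0\<close> l r(1) by (simp add: q_def)
    have "q t * l * (r * exp t) = C * exp (- t / (2 * (real m)\<^sup>2)) * exp t" using l r(1) by (simp add: q_def)
    then have close': "\<bar>support (X t) u - l * support (Y t) u - u \<bullet> ((exp t / m) *\<^sub>R b)\<bar>
        \<le> q t * l * (r * exp t) * norm u" for u
      using close[OF elim(2), of u] by (simp only:)
    have "body_dist (X t) (Y t) \<le> 2 * q t / \<kappa> * (1 + (R * exp t) / (r * exp t))"
      unfolding \<kappa>_def
      by (rule body_dist_le_support[where y = "y t" and c = "(exp t / m) *\<^sub>R b" and l = l, OF _ _ _ _ _ _ _ _ close'])
        (use r elim q l hukuhara_solution_conv_sets[OF X(1)] hukuhara_solution_conv_sets[OF Y(1)] in auto)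
    moreover have "body_dist (X t) (Y t) \<ge> 0"
      by (rule body_dist_nonneg[OF hukuhara_solution_conv_sets[OF X(1) elim(2)]])
    ultimately show ?case
      using hukuhara_solution_conv_bodies[OF A X elim(2)] hukuhara_solution_conv_bodies[OF A Y elim(2)]
      by (simp add: rho_orbit mult_ac)
  qed
  show ?thesis
    by (rule Lim_null_comparison[OF bound tendsto_mult_left_zero[OF q0]])
qed

theorem theorem4p2:
  fixes A :: "real^2 \<Rightarrow> real^2"
    and m :: nat
    and X0s :: "(real^2) set"
    and Xs :: "real \<Rightarrow> (real^2) set"
  assumes "orthogonal_transformation A"
    and "m > 0"
    and "A ^^ m = id"
    and "X0s \<in> conv_bodies"
    and "hukuhara_solution A X0s Xs"
  shows "conditionally_asymptotically_stable A Xs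
    {X0 \<in> conv_sets. interior X0 \<noteq> {} \<and>
      (\<Sum>p<m. (A ^^ p) ` X0) \<in> orbit (\<Sum>p<m. (A ^^ p) ` X0s)}"
proof -
  have "Xs 0 = X0s" using assms(5) by (simp add: hukuhara_solution_def)
  \<comment> \<open>The radius \<open>1\<close> is an arbitrary positive witness, since attractivity
    is available for every initial body in the given set.\<close>
  then show ?thesis
    unfolding conditionally_asymptotically_stable_def
    using conv_bodies_orbit_stability[OF assms(1-3) assms(5,4)]
      conv_bodies_orbit_attractivity[OF assms(1-3) assms(5,4)]
    by (intro conjI exI[of _ 1]) (auto simp: conv_bodies_def)
qed

end
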